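(* Let $k$ be a field, $n\geq1$ and $A=k[x_1,\ldots,x_n]/\langle x_1\cdots x_n\rangle$. Let $f=(e_It^{(p)},\mathbf{x}^\alpha)$ and $g=(e_Jt^{(q)},\mathbf{x}^\beta)$ be (standard) cocycles in $\mathrm{HH}^*(A)$. Then $$f\smile g=\begin{cases}\mathrm{sgn}(I,J)\cdot(e_{I\cup J}t^{(p+q)},\mathbf{x}^{\alpha+\beta}),&\text{if }I\cap J=\emptyset,\\0,&\text{otherwise.}\end{cases}$$ Moreover, this multiplication is commutative up to sign.
   Context: Put $A^e=A\otimes_k A$. Let $F_\bullet$ be the following free resolution of the $A^e$-module $A$ (with augmentation $\epsilon:F_0=A^e\to A$, $a\otimes b\mapsto ab$): $F_m$ is the free $A^e$-module with basis the symbols $e_It^{(q)}$, where $I\subseteq[n]=\{1,\ldots,n\}$, $q\geq0$, $|I|+2q=m$, and $e_I=e_{i_1}\wedge\cdots\wedge e_{i_s}$ for $I=\{i_1<\cdots<i_s\}$. The differential is $d(e_It^{(q)})=\sum_{j=1}^s(-1)^{j-1}(1\otimes x_{i_j}-x_{i_j}\otimes1)e_{I\smallsetminus\{i_j\}}t^{(q)}+\sum_{j=1}^n(x_1\cdots x_{j-1}\otimes x_{j+1}\cdots x_n)\,e_j\wedge e_I\,t^{(q-1)}$, the second sum being omitted if $q=0$. Then $\mathrm{HH}^*(A)$ is the cohomology of $\mathrm{Hom}_{A^e}(F_\bullet,A)$, whose differential is $f\mapsto f\circ d$. For a monomial $\mathbf{x}^\alpha=x_1^{\alpha_1}\cdots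 x_n^{\alpha_n}$ not divisible by $x_1\cdots x_n$ (these form a $k$-basis of $A$) and a basis element $e_It^{(q)}$ of $F_m$, the standard element $(e_It^{(q)},\mathbf{x}^\alpha)\in\mathrm{Hom}_{A^e}(F_m,A)$ is the $A^e$-linear map sending $e_It^{(q)}$ to $\mathbf{x}^\alpha$ and every other basis element to $0$; the same notation is used for its class in $\mathrm{HH}^*(A)$ when it is a cocycle. The symbol $(e_{I\cup J}t^{(p+q)},\mathbf{x}^{\alpha+\beta})$ is $0$ if $\mathbf{x}^{\alpha+\beta}=0$ in $A$. For disjoint $M,N\subseteq[n]$, $\mathrm{sgn}(M,N)\in\{1,-1\}$ is defined by $e_M\wedge e_N=\mathrm{sgn}(M,N)\,e_{M\cup N}$. Product: for cocycles $f\in\mathrm{Hom}_{A^e}(F_i,A)$ and $g\in\mathrm{Hom}_{A^e}(F_j,A)$, choose $A^e$-homomorphisms $\tilde f_l:F_{i+l}\to F_l$ ($l\ge0$) with $\epsilon\circ\tilde f_0=f$ and $d_l\circ\tilde f_l=\tilde f_{l-1}\circ d_{i+l}$ for $l\geq1$. Then $f\smile g:=g\circ\tilde f_j\in\mathrm{Hom}_{A^e}(F_{i+j},A)$, which induces a well-defined product on $\mathrm{HH}^*(A)$ (the Yoneda product, equivalent to the cup product).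
   Formalization: Here f⌣g means (-1)^{ij} times the class of g∘f̃_j (the usual cup product). For g∘f̃_j itself the formula would have sgn(J,I) in place of sgn(I,J), so it fails if char k≠2, e.g. n=3, f=(e_1,x_1), g=(e_2,x_2). *)

theory Defs
  imports "HOL-Library.Poly_Mapping" "HOL-Library.FuncSet"
begin

section \<open>The algebra \<open>A = k[x\<^sub>1,\<dots>,x\<^sub>n] / (x\<^sub>1 \<cdots> x\<^sub>n)\<close>\<close>

text \<open>
  The index set \<open>[n]\<close> is a type \<open>'n\<close> of classes \<open>finite\<close> and \<open>linorder\<close>, with \<open>n = CARD('n) \<ge> 1\<close>;
  such a type is, as an ordered set, \<open>{1 < \<dots> < n}\<close>.
\<close>

type_synonym ('n, 'k) mpoly = "('n \<Rightarrow>\<^sub>0 nat) \<Rightarrow>\<^sub>0 'k"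

definition pmonom :: "('n \<Rightarrow>\<^sub>0 nat) \<Rightarrow> ('n, 'k::field) mpoly" where
  "pmonom \<alpha> = Poly_Mapping.single \<alpha> 1"

definition pvar :: "'n \<Rightarrow> ('n, 'k::field) mpoly" where
  "pvar i = pmonom (Poly_Mapping.single i 1)"

definition pvar_prod :: "('n::finite, 'k::field) mpoly" where
  "pvar_prod = (\<Prod>i\<in>UNIV. pvar i)"

definition alg_rel :: "('n::finite, 'k::field) mpoly \<Rightarrow> ('n, 'k) mpoly \<Rightarrow> bool" where
  "alg_rel u v \<longleftrightarrow> pvar_prod dvd u - v"

lemma equivp_alg_rel: "equivp (alg_rel :: ('n::finite, 'k::field) mpoly \<Rightarrow> _)"
proof (rule equivpI)
  show "reflp (alg_rel :: ('n, 'k) mpoly \<Rightarrow> _)"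
    by (simp add: reflp_def alg_rel_def)
  show "symp (alg_rel :: ('n, 'k) mpoly \<Rightarrow> _)"
  proof (rule sympI)
    fix u v :: "('n, 'k) mpoly"
    assume "alg_rel u v"
    then have "pvar_prod dvd - (u - v)"
      unfolding alg_rel_def by (simp only: dvd_minus_iff)
    then show "alg_rel v u"
      by (simp add: alg_rel_def)
  qed
  show "transp (alg_rel :: ('n, 'k) mpoly \<Rightarrow> _)"
  proof (rule transpI)
    fix u v w :: "('n, 'k) mpoly"
    assume "alg_rel u v" "alg_rel v w"
    then have "pvar_prod dvd (u - v) + (v - w)"
      unfolding alg_rel_def by (rule dvd_add)
    then show "alg_rel u w"
      by (simp add: alg_rel_def)
  qed
qed

lemma alg_rel_eqI: "u = v \<Longrightarrow> alg_rel u v"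
  by (simp add: alg_rel_def)

quotient_type (overloaded) ('n, 'k) alg = "('n::finite, 'k::field) mpoly" / alg_rel
  by (rule equivp_alg_rel)

lemma pvar_prod_not_dvd_one: "\<not> (pvar_prod :: ('n::finite, 'k::field) mpoly) dvd 1"
proof
  assume "(pvar_prod :: ('n, 'k) mpoly) dvd 1"
  moreover have "(pvar undefined :: ('n, 'k) mpoly) dvd pvar_prod"
    unfolding pvar_prod_def by (rule dvd_prodI) auto
  ultimately have "(pvar undefined :: ('n, 'k) mpoly) dvd 1"
    by (rule dvd_trans[rotated])
  then obtain q :: "('n, 'k) mpoly" where q: "1 = pvar undefined * q" ..
  have "0 \<notin> Poly_Mapping.keys (pvar undefined * q)"
  proof
    assume "0 \<in> Poly_Mapping.keys (pvar undefined * q)"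
    then obtain a b :: "'n \<Rightarrow>\<^sub>0 nat"
      where ab: "0 = a + b" "a \<in> Poly_Mapping.keys (pvar undefined :: ('n, 'k) mpoly)"
      using keys_mult by blast
    then have a: "a = Poly_Mapping.single undefined 1"
      by (simp add: pvar_def pmonom_def)
    have "Poly_Mapping.lookup (a + b) undefined = 0"
      using ab(1) by (metis lookup_zero)
    then show False
      by (simp add: a lookup_add)
  qed
  then show False
    by (metis q keys_one singletonI)
qed

instantiation alg :: (finite, field) comm_ring_1
begin

lift_definition zero_alg :: "('a, 'b) alg" is 0 .

lift_definition one_alg :: "('a, 'b) alg" is 1 .

lift_definition plus_alg :: "('a, 'b) alg \<Rightarrow> ('a, 'b) alg \<Rightarrow> ('a, 'b) alg" is "(+)"
proof -
  fix u u' v v' :: "('a, 'b) mpoly"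
  assume "alg_rel u u'" "alg_rel v v'"
  then have "pvar_prod dvd (u - u') + (v - v')"
    unfolding alg_rel_def by (rule dvd_add)
  then show "alg_rel (u + v) (u' + v')"
    unfolding alg_rel_def by (simp add: algebra_simps)
qed

lift_definition uminus_alg :: "('a, 'b) alg \<Rightarrow> ('a, 'b) alg" is uminus
proof -
  fix u u' :: "('a, 'b) mpoly"
  assume "alg_rel u u'"
  then have "pvar_prod dvd - (u - u')"
    unfolding alg_rel_def by (simp only: dvd_minus_iff)
  then show "alg_rel (- u) (- u')"
    unfolding alg_rel_def by (simp add: algebra_simps)
qed

lift_definition minus_alg :: "('a, 'b) alg \<Rightarrow> ('a, 'b) alg \<Rightarrow> ('a, 'b) alg" is "(-)"
proof -
  fix u u' v v' :: "('a, 'b) mpoly"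
  assume "alg_rel u u'" "alg_rel v v'"
  then have "pvar_prod dvd (u - u') - (v - v')"
    unfolding alg_rel_def by (rule dvd_diff)
  then show "alg_rel (u - v) (u' - v')"
    unfolding alg_rel_def by (simp add: algebra_simps)
qed

lift_definition times_alg :: "('a, 'b) alg \<Rightarrow> ('a, 'b) alg \<Rightarrow> ('a, 'b) alg" is "(*)"
proof -
  fix u u' v v' :: "('a, 'b) mpoly"
  assume "alg_rel u u'" "alg_rel v v'"
  then have "pvar_prod dvd v * (u - u') + u' * (v - v')"
    unfolding alg_rel_def by (intro dvd_add dvd_mult)
  then show "alg_rel (u * v) (u' * v')"
    unfolding alg_rel_def by (simp add: algebra_simps)
qed

instance
proof
  show "(0 :: ('a, 'b) alg) \<noteq> 1"
    by transfer (metis alg_rel_def diff_0 dvd_minus_iff pvar_prod_not_dvd_one)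
qed (transfer, rule alg_rel_eqI, simp add: algebra_simps)+

end

lift_definition amonom :: "('n::finite \<Rightarrow>\<^sub>0 nat) \<Rightarrow> ('n, 'k::field) alg" is pmonom .

lift_definition avar :: "'n::finite \<Rightarrow> ('n, 'k::field) alg" is pvar .

lift_definition aconst :: "'k::field \<Rightarrow> ('n::finite, 'k) alg" is "Poly_Mapping.single 0" .

section \<open>The enveloping algebra \<open>A\<^sup>e = A \<otimes>\<^sub>k A\<close>\<close>

text \<open>
  The set \<open>A \<times> A\<close> with componentwise multiplication, written additively because
  \<^typ>\<open>'a \<Rightarrow>\<^sub>0 'b\<close> is a monoid algebra for an additively written monoid. The monoid algebra
  \<open>k[A \<times> A]\<close> is the free \<open>k\<close>-vector space on \<open>A \<times> A\<close> with product \<open>(a,b)(c,d) = (ac,bd)\<close>. The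
  product of a \<open>k\<close>-bilinearity relation with a basis element is again such a relation, so the ideal
  generated by these relations is their \<open>k\<close>-span, and the quotient is the tensor product of algebras.
\<close>

datatype 'a pure = Pure 'a 'a

instantiation pure :: (comm_monoid_mult) comm_monoid_add
begin

definition zero_pure :: "'a pure" where "0 = Pure 1 1"

fun plus_pure :: "'a pure \<Rightarrow> 'a pure \<Rightarrow> 'a pure" where
  "Pure a b + Pure c d = Pure (a * c) (b * d)"

instance
proof
  fix u v w :: "'a pure"
  show "u + v + w = u + (v + w)" by (cases u; cases v; cases w) (simp add: mult.assoc)
  show "u + v = v + u" by (cases u; cases v) (simp add: mult.commute)
  show "0 + u = u" by (cases u) (simp add: zero_pure_def)
qed

end

type_synonym ('n, 'k) pure_alg = "('n, 'k) alg pure \<Rightarrow>\<^sub>0 'k"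

abbreviation pure_elt ::
  "('n::finite, 'k::field) alg \<Rightarrow> ('n, 'k) alg \<Rightarrow> ('n, 'k) pure_alg" where
  "pure_elt a b \<equiv> Poly_Mapping.single (Pure a b) 1"

inductive_set tensor_ideal :: "('n::finite, 'k::field) pure_alg set" where
  add_left: "pure_elt (a + a') b - pure_elt a b - pure_elt a' b \<in> tensor_ideal"
| add_right: "pure_elt a (b + b') - pure_elt a b - pure_elt a b' \<in> tensor_ideal"
| scale_left: "pure_elt (aconst c * a) b - Poly_Mapping.single (Pure a b) c \<in> tensor_ideal"
| scale_right: "pure_elt a (aconst c * b) - Poly_Mapping.single (Pure a b) c \<in> tensor_ideal"
| zero: "0 \<in> tensor_ideal"
| add: "u \<in> tensor_ideal \<Longrightarrow> v \<in> tensor_ideal \<Longrightarrow> u + v \<in> tensor_ideal"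
| mult: "u \<in> tensor_ideal \<Longrightarrow> r * u \<in> tensor_ideal"

definition env_rel :: "('n::finite, 'k::field) pure_alg \<Rightarrow> ('n, 'k) pure_alg \<Rightarrow> bool" where
  "env_rel u v \<longleftrightarrow> u - v \<in> tensor_ideal"

lemma tensor_ideal_uminus: "u \<in> tensor_ideal \<Longrightarrow> - u \<in> tensor_ideal"
  using tensor_ideal.mult[of u "-1"] by simp

lemma equivp_env_rel: "equivp (env_rel :: ('n::finite, 'k::field) pure_alg \<Rightarrow> _)"
proof (rule equivpI)
  show "reflp (env_rel :: ('n, 'k) pure_alg \<Rightarrow> _)"
    by (simp add: reflp_def env_rel_def tensor_ideal.zero)
  show "symp (env_rel :: ('n, 'k) pure_alg \<Rightarrow> _)"
    unfolding symp_def env_rel_def by (metis tensor_ideal_uminus minus_diff_eq)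
  show "transp (env_rel :: ('n, 'k) pure_alg \<Rightarrow> _)"
  proof (rule transpI)
    fix u v w :: "('n, 'k) pure_alg"
    assume "env_rel u v" "env_rel v w"
    then have "(u - v) + (v - w) \<in> tensor_ideal"
      unfolding env_rel_def by (rule tensor_ideal.add)
    then show "env_rel u w"
      by (simp add: env_rel_def)
  qed
qed

text \<open>The linear extension of \<open>(a, b) \<mapsto> ab\<close>, which induces the augmentation \<open>\<epsilon> : A\<^sup>e \<rightarrow> A\<close>.\<close>

fun pure_mult :: "('n::finite, 'k::field) alg pure \<Rightarrow> ('n, 'k) alg" where
  "pure_mult (Pure a b) = a * b"

definition pure_eps :: "('n::finite, 'k::field) pure_alg \<Rightarrow> ('n, 'k) alg" where
  "pure_eps u = (\<Sum>s\<in>Poly_Mapping.keys u. aconst (Poly_Mapping.lookup u s) * pure_mult s)"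

lemma aconst_0: "aconst 0 = 0" by transfer (simp add: alg_rel_def)
lemma aconst_1: "aconst 1 = 1" by transfer (simp add: alg_rel_def)
lemma aconst_add: "aconst (a + b) = aconst a + aconst b"
  by transfer (simp add: alg_rel_def single_add)
lemma aconst_mult: "aconst (a * b) = aconst a * aconst b"
  by transfer (simp add: alg_rel_def mult_single)

lemma pure_eps_add: "pure_eps (u + v) = pure_eps u + pure_eps v"
  unfolding pure_eps_def
  by (rule setsum_keys_plus_distrib) (simp_all add: aconst_0 aconst_add distrib_right)

lemma pure_eps_0: "pure_eps 0 = 0"
  by (simp add: pure_eps_def)

lemma pure_eps_uminus: "pure_eps (- u) = - pure_eps u"
  using pure_eps_add[of u "- u"] by (simp add: pure_eps_0 add_eq_0_iff)

lemma pure_eps_diff: "pure_eps (u - v) = pure_eps u - pure_eps v"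
  using pure_eps_add[of u "- v"] by (simp add: pure_eps_uminus)

lemma pure_eps_single: "pure_eps (Poly_Mapping.single s c) = aconst c * pure_mult s"
  by (cases "c = 0") (simp_all add: pure_eps_def aconst_0)

lemma pure_mult_add: "pure_mult (s + t) = pure_mult s * pure_mult t"
  by (cases s; cases t) (simp add: ac_simps)

lemma pure_alg_induct:
  fixes P :: "('n::finite, 'k::field) pure_alg \<Rightarrow> bool"
  assumes "P 0" "\<And>s c. P (Poly_Mapping.single s c)" "\<And>u v. P u \<Longrightarrow> P v \<Longrightarrow> P (u + v)"
  shows "P u"
proof (induction u rule: update_induct)
  case const
  show ?case by (rule assms(1))
next
  case (update f a b)
  have "Poly_Mapping.update a b f = f + Poly_Mapping.single a b"
    using update.hyps(1)
    by (intro poly_mapping_eqI)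
      (auto simp: lookup_update lookup_add lookup_single in_keys_iff when_def)
  then show ?case
    using assms(2,3) update by simp
qed

lemma pure_eps_mult: "pure_eps (u * v) = pure_eps u * pure_eps v"
proof (induction u rule: pure_alg_induct)
  case (2 s c)
  show ?case
  proof (induction v rule: pure_alg_induct)
    case (2 t d)
    show ?case by (simp add: mult_single pure_eps_single aconst_mult pure_mult_add ac_simps)
  qed (simp_all add: pure_eps_0 pure_eps_add distrib_left)
qed (simp_all add: pure_eps_0 pure_eps_add distrib_right)

lemma pure_eps_tensor_ideal: "u \<in> tensor_ideal \<Longrightarrow> pure_eps u = 0"
  by (induction rule: tensor_ideal.induct)
    (simp_all add: pure_eps_0 pure_eps_add pure_eps_diff pure_eps_mult pure_eps_single aconst_1
      algebra_simps)

lemma env_rel_eqI: "u = v \<Longrightarrow> env_rel u v"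
  by (simp add: env_rel_def tensor_ideal.zero)

quotient_type (overloaded) ('n, 'k) env = "('n::finite, 'k::field) pure_alg" / env_rel
  by (rule equivp_env_rel)

instantiation env :: (finite, field) comm_ring_1
begin

lift_definition zero_env :: "('a, 'b) env" is 0 .

lift_definition one_env :: "('a, 'b) env" is 1 .

lift_definition plus_env :: "('a, 'b) env \<Rightarrow> ('a, 'b) env \<Rightarrow> ('a, 'b) env" is "(+)"
proof -
  fix u u' v v' :: "('a, 'b) pure_alg"
  assume "env_rel u u'" "env_rel v v'"
  then have "(u - u') + (v - v') \<in> tensor_ideal"
    unfolding env_rel_def by (rule tensor_ideal.add)
  then show "env_rel (u + v) (u' + v')"
    unfolding env_rel_def by (simp add: algebra_simps)
qed

lift_definition uminus_env :: "('a, 'b) env \<Rightarrow> ('a, 'b) env" is uminus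
proof -
  fix u u' :: "('a, 'b) pure_alg"
  assume "env_rel u u'"
  then have "- (u - u') \<in> tensor_ideal"
    unfolding env_rel_def by (rule tensor_ideal_uminus)
  then show "env_rel (- u) (- u')"
    unfolding env_rel_def by (simp add: algebra_simps)
qed

lift_definition minus_env :: "('a, 'b) env \<Rightarrow> ('a, 'b) env \<Rightarrow> ('a, 'b) env" is "(-)"
proof -
  fix u u' v v' :: "('a, 'b) pure_alg"
  assume "env_rel u u'" "env_rel v v'"
  then have "(u - u') + - (v - v') \<in> tensor_ideal"
    unfolding env_rel_def by (blast intro: tensor_ideal.add tensor_ideal_uminus)
  then show "env_rel (u - v) (u' - v')"
    unfolding env_rel_def by (simp add: algebra_simps)
qed

lift_definition times_env :: "('a, 'b) env \<Rightarrow> ('a, 'b) env \<Rightarrow> ('a, 'b) env" is "(*)"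
proof -
  fix u u' v v' :: "('a, 'b) pure_alg"
  assume "env_rel u u'" "env_rel v v'"
  then have "v * (u - u') + u' * (v - v') \<in> tensor_ideal"
    unfolding env_rel_def by (blast intro: tensor_ideal.add tensor_ideal.mult)
  then show "env_rel (u * v) (u' * v')"
    unfolding env_rel_def by (simp add: algebra_simps)
qed

instance
proof
  show "(0 :: ('a, 'b) env) \<noteq> 1"
  proof transfer
    show "\<not> env_rel (0 :: ('a, 'b) pure_alg) 1"
    proof
      assume "env_rel (0 :: ('a, 'b) pure_alg) 1"
      then have "pure_eps (0 - 1 :: ('a, 'b) pure_alg) = 0"
        unfolding env_rel_def by (rule pure_eps_tensor_ideal)
      moreover have "pure_eps (1 :: ('a, 'b) pure_alg) = 1"
        using pure_eps_single[of 0 1, unfolded single_one] by (simp add: aconst_1 zero_pure_def)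
      ultimately show False
        by (simp add: pure_eps_uminus)
    qed
  qed
qed (transfer, rule env_rel_eqI, simp add: algebra_simps)+

end

lift_definition tensor ::
  "('n::finite, 'k::field) alg \<Rightarrow> ('n, 'k) alg \<Rightarrow> ('n, 'k) env" (infixl "\<otimes>" 72)
  is "\<lambda>a b. pure_elt a b" .

lift_definition eps :: "('n::finite, 'k::field) env \<Rightarrow> ('n, 'k) alg" is pure_eps
  unfolding env_rel_def by (drule pure_eps_tensor_ideal) (simp add: pure_eps_diff)

text \<open>\<open>A\<close> as an \<open>A\<^sup>e\<close>-module: \<open>(a \<otimes> b) \<cdot> m = amb\<close>, which is \<open>\<epsilon>(a \<otimes> b) m\<close> as \<open>A\<close> is commutative.\<close>

definition act :: "('n::finite, 'k::field) env \<Rightarrow> ('n, 'k) alg \<Rightarrow> ('n, 'k) alg" where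
  "act w m = eps w * m"

section \<open>The resolution \<open>F\<^sub>\<bullet>\<close>\<close>

text \<open>The pair \<open>(I, q)\<close> stands for the symbol \<open>e\<^sub>I t\<^sup>(\<^sup>q\<^sup>)\<close>; the type below is \<open>\<Oplus>\<^sub>m F\<^sub>m\<close>.\<close>

type_synonym ('n, 'k) res = "('n set \<times> nat) \<Rightarrow>\<^sub>0 ('n, 'k) env"

definition F :: "nat \<Rightarrow> ('n::finite, 'k::field) res set" where
  "F m = {v. \<forall>(I, q)\<in>Poly_Mapping.keys v. card I + 2 * q = m}"

definition smul :: "('n::finite, 'k::field) env \<Rightarrow> ('n, 'k) res \<Rightarrow> ('n, 'k) res" where
  "smul w v = Poly_Mapping.map ((*) w) v"

definition gen :: "'n set \<Rightarrow> nat \<Rightarrow> ('n::finite, 'k::field) res" where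
  "gen I q = Poly_Mapping.single (I, q) 1"

text \<open>
  Sorting \<open>e\<^sub>M \<and> e\<^sub>N\<close> into increasing order takes one transposition of adjacent factors for each pair
  \<open>(a, b) \<in> M \<times> N\<close> with \<open>b < a\<close>.
\<close>

definition wsgn :: "'n::{finite,linorder} set \<Rightarrow> 'n set \<Rightarrow> int" where
  "wsgn M N = (-1) ^ card {(a, b). a \<in> M \<and> b \<in> N \<and> b < a}"

text \<open>The element \<open>(e\<^sub>M \<and> e\<^sub>N) t\<^sup>(\<^sup>q\<^sup>)\<close>.\<close>

definition wedge_gen :: "'n::{finite,linorder} set \<Rightarrow> 'n set \<Rightarrow> nat \<Rightarrow> ('n, 'k::field) res" where
  "wedge_gen M N q =
    (if M \<inter> N = {} then smul (of_int (wsgn M N)) (gen (M \<union> N) q) else 0)"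

definition d_gen :: "'n::{finite,linorder} set \<Rightarrow> nat \<Rightarrow> ('n, 'k::field) res" where
  "d_gen I q =
    (\<Sum>i\<in>I. smul ((-1) ^ card {i'\<in>I. i' < i} * (1 \<otimes> avar i - avar i \<otimes> 1)) (gen (I - {i}) q)) +
    (if q = 0 then 0
     else \<Sum>j\<in>UNIV. smul ((\<Prod>i\<in>{..<j}. avar i) \<otimes> (\<Prod>i\<in>{j<..}. avar i))
                          (wedge_gen {j} I (q - 1)))"

definition dF :: "('n::{finite,linorder}, 'k::field) res \<Rightarrow> ('n, 'k) res" where
  "dF v = (\<Sum>(I, q)\<in>Poly_Mapping.keys v. smul (Poly_Mapping.lookup v (I, q)) (d_gen I q))"

text \<open>The augmentation \<open>F\<^sub>0 = A\<^sup>e e\<^sub>\<emptyset> t\<^sup>(\<^sup>0\<^sup>) \<rightarrow> A\<close>.\<close>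

definition aug :: "('n::finite, 'k::field) res \<Rightarrow> ('n, 'k) alg" where
  "aug v = eps (Poly_Mapping.lookup v ({}, 0))"

section \<open>Hochschild cohomology\<close>

text \<open>
  Elements of \<open>Hom\<^bsub>A\<^sup>e\<^esub>(F\<^sub>m, A)\<close> are functions on all of \<open>\<Oplus>\<^sub>m F\<^sub>m\<close>, normalised to be \<open>undefined\<close>
  outside \<open>F\<^sub>m\<close>; all operations on cochains are restricted accordingly.
\<close>

type_synonym ('n, 'k) cochain = "('n, 'k) res \<Rightarrow> ('n, 'k) alg"

definition HomFA :: "nat \<Rightarrow> ('n::finite, 'k::field) cochain set" where
  "HomFA m = {f \<in> extensional (F m).
     (\<forall>v\<in>F m. \<forall>w\<in>F m. f (v + w) = f v + f w) \<and> (\<forall>c. \<forall>v\<in>F m. f (smul c v) = act c (f v))}"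

definition HomFF :: "nat \<Rightarrow> nat \<Rightarrow> (('n::finite, 'k::field) res \<Rightarrow> ('n, 'k) res) set" where
  "HomFF m l = {f \<in> F m \<rightarrow>\<^sub>E F l.
     (\<forall>v\<in>F m. \<forall>w\<in>F m. f (v + w) = f v + f w) \<and> (\<forall>c. \<forall>v\<in>F m. f (smul c v) = smul c (f v))}"

definition zero_cochain :: "nat \<Rightarrow> ('n::finite, 'k::field) cochain" where
  "zero_cochain m = (\<lambda>v\<in>F m. 0)"

definition delta :: "nat \<Rightarrow> ('n::{finite,linorder}, 'k::field) cochain \<Rightarrow> ('n, 'k) cochain" where
  "delta m f = (\<lambda>v\<in>F (Suc m). f (dF v))"

definition cocycles :: "nat \<Rightarrow> ('n::{finite,linorder}, 'k::field) cochain set" where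
  "cocycles m = {f \<in> HomFA m. delta m f = zero_cochain (Suc m)}"

primrec coboundaries :: "nat \<Rightarrow> ('n::{finite,linorder}, 'k::field) cochain set" where
  "coboundaries 0 = {zero_cochain 0}"
| "coboundaries (Suc m) = delta m ` HomFA m"

definition HH_class ::
  "nat \<Rightarrow> ('n::{finite,linorder}, 'k::field) cochain \<Rightarrow> ('n, 'k) cochain set" where
  "HH_class m f = {g \<in> cocycles m. (\<lambda>v\<in>F m. g v - f v) \<in> coboundaries m}"

definition HH :: "nat \<Rightarrow> ('n::{finite,linorder}, 'k::field) cochain set set" where
  "HH m = HH_class m ` cocycles m"

definition HH_scale ::
  "nat \<Rightarrow> int \<Rightarrow> ('n::{finite,linorder}, 'k::field) cochain set \<Rightarrow> ('n, 'k) cochain set" where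
  "HH_scale m c U = (\<Union>f\<in>U. HH_class m (\<lambda>v\<in>F m. of_int c * f v))"

text \<open>The standard element \<open>(e\<^sub>I t\<^sup>(\<^sup>q\<^sup>), x\<^sup>\<alpha>)\<close>.\<close>

definition std ::
  "'n::finite set \<Rightarrow> nat \<Rightarrow> ('n \<Rightarrow>\<^sub>0 nat) \<Rightarrow> ('n, 'k::field) cochain" where
  "std I q \<alpha> = (\<lambda>v\<in>F (card I + 2 * q). act (Poly_Mapping.lookup v (I, q)) (amonom \<alpha>))"

section \<open>The product\<close>

definition is_lift ::
  "nat \<Rightarrow> ('n::{finite,linorder}, 'k::field) cochain \<Rightarrow> (nat \<Rightarrow> ('n, 'k) res \<Rightarrow> ('n, 'k) res) \<Rightarrow> bool"
  where
  "is_lift i f ft \<longleftrightarrow>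
     (\<forall>l. ft l \<in> HomFF (i + l) l) \<and>
     (\<forall>v\<in>F i. aug (ft 0 v) = f v) \<and>
     (\<forall>l. \<forall>v\<in>F (i + Suc l). dF (ft (Suc l) v) = ft l (dF v))"

text \<open>
  The set of all cocycles cohomologous to \<open>g \<circ> ft\<^sub>j\<close>, for any choice of representatives \<open>f\<close>, \<open>g\<close> and
  of the lift \<open>ft\<close>. It is a single cohomology class exactly if lifts exist and the class does not
  depend on the choices.
\<close>

definition yoneda ::
  "nat \<Rightarrow> nat \<Rightarrow> ('n::{finite,linorder}, 'k::field) cochain set \<Rightarrow> ('n, 'k) cochain set \<Rightarrow>
    ('n, 'k) cochain set" where
  "yoneda i j U V =
     (\<Union>f\<in>U. \<Union>g\<in>V. \<Union>ft\<in>{ft. is_lift i f ft}. HH_class (i + j) (\<lambda>v\<in>F (i + j). g (ft j v)))"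

text \<open>
  The lifts above commute with the differentials strictly. On the bar resolution the strict lift of
  a cocycle \<open>f\<close> of degree \<open>i\<close> is
  \<open>1[a\<^sub>1|\<dots>|a\<^bsub>i+l\<^esub>]1 \<mapsto> (-1)\<^sup>i\<^sup>l f(a\<^sub>1,\<dots>,a\<^sub>i)[a\<^bsub>i+1\<^esub>|\<dots>|a\<^bsub>i+l\<^esub>]1\<close>, so the cup product
  \<open>f(a\<^sub>1,\<dots>,a\<^sub>i) g(a\<^bsub>i+1\<^esub>,\<dots>,a\<^bsub>i+j\<^esub>)\<close> is \<open>(-1)\<^sup>i\<^sup>j\<close> times the Yoneda composite. Equivalently, one requires
  \<open>d ft\<^sub>l = (-1)\<^sup>i ft\<^bsub>l-1\<^esub> d\<close>. Without this sign, \<open>f \<smile> g\<close> involves \<open>sgn(J, I)\<close> in place of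
  \<open>sgn(I, J)\<close>: for \<open>n = 3\<close>, \<open>f = (e\<^sub>1, x\<^sub>1)\<close> and \<open>g = (e\<^sub>2, x\<^sub>2)\<close>, one has
  \<open>ft\<^sub>0(d(e\<^sub>1 \<and> e\<^sub>2)) = -(1 \<otimes> x\<^sub>2 - x\<^sub>2 \<otimes> 1)(x\<^sub>1 \<otimes> 1)\<close>, hence \<open>g(ft\<^sub>1(e\<^sub>1 \<and> e\<^sub>2)) = -x\<^sub>1x\<^sub>2\<close>.
\<close>

definition cup ::
  "nat \<Rightarrow> nat \<Rightarrow> ('n::{finite,linorder}, 'k::field) cochain set \<Rightarrow> ('n, 'k) cochain set \<Rightarrow>
    ('n, 'k) cochain set" where
  "cup i j U V = HH_scale (i + j) ((-1) ^ (i * j)) (yoneda i j U V)"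

end

theory Submission
  imports Defs
begin

text \<open>
  An element of \<open>\<Oplus>\<^sub>m F\<^sub>m\<close> is identified with its coefficient function, so that the differential is
  \<open>\<Sum>\<^sub>i \<theta>\<^sub>i \<iota>\<^sub>i + \<Sum>\<^sub>j c\<^sub>j (e\<^sub>j \<and>) \<partial>\<close> with \<open>\<theta>\<^sub>i = 1 \<otimes> x\<^sub>i - x\<^sub>i \<otimes> 1\<close>, contractions \<open>\<iota>\<^sub>i\<close>,
  \<open>c\<^sub>j = x\<^sub>1 \<cdots> x\<^bsub>j-1\<^esub> \<otimes> x\<^bsub>j+1\<^esub> \<cdots> x\<^sub>n\<close> and \<open>\<partial> : t\<^sup>(\<^sup>q\<^sup>) \<mapsto> t\<^sup>(\<^sup>q\<^sup>-\<^sup>1\<^sup>)\<close>. Since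
  \<open>\<Sum>\<^bsub>j>i\<^esub> c\<^sub>j \<theta>\<^sub>j = (x\<^sub>i \<otimes> 1) c\<^sub>i\<close>, the operators \<open>X\<^sub>i = x\<^sub>i \<iota>\<^sub>i - \<Sum>\<^bsub>j>i\<^esub> c\<^sub>j (e\<^sub>j \<and>) \<partial>\<close> anticommute with the
  differential. A cochain \<open>f\<close> is a cocycle only if \<open>f(e\<^sub>I t\<^sup>(\<^sup>p\<^sup>))\<close> is a multiple \<open>x\<^sub>I a\<close> of \<open>x\<^sub>I = \<Prod>\<^bsub>i\<in>I\<^esub> x\<^sub>i\<close>,
  so the operators \<open>a X\<^sub>I \<partial>\<^sup>p\<close> add up to a lift of \<open>f\<close>, up to signs. The extra terms of \<open>X\<^sub>i\<close> do not contribute to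
  the product, because \<open>x\<^sub>j \<epsilon>(c\<^sub>j) = x\<^sub>1 \<cdots> x\<^sub>n = 0\<close>; this gives the product of any two cocycles on the
  cochain level, and its commutativity up to sign.

  That the class does not depend on the choice of lifts requires the exactness of \<open>F\<^sub>\<bullet>\<close>. It is deduced from
  \<open>A\<^sup>e = R / (y\<^sub>1 \<cdots> y\<^sub>n)\<close> for \<open>R = A[y\<^sub>1,\<dots>,y\<^sub>n]\<close>: over \<open>R\<close>, the Koszul complex of the
  \<open>y\<^sub>i - x\<^sub>i\<close> is exact, and the differential \<open>D\<close> lifted to \<open>R\<close> satisfies \<open>D\<^sup>2 = y\<^sub>1 \<cdots> y\<^sub>n \<partial>\<close>.
\<close>

section \<open>Contractions and exterior multiplications\<close>

text \<open>The sign that sorts \<open>e_i\<close> into \<open>e_I\<close>, used for wedging and for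
  contracting with \<open>i\<close>. It takes values in any ring because the same operators act over
  \<open>A\<close>, \<open>A^e\<close> and \<open>A[y]\<close>.\<close>

definition sg :: "'n::{finite,linorder} \<Rightarrow> 'n set \<Rightarrow> 'r::comm_ring_1" where
  "sg i I = (-1) ^ card {k\<in>I. k < i}"

lemma sg_sq: "sg i I * sg i I = 1"
  by (simp add: sg_def flip: power_add)

lemma sg_sq_left: "sg i I * (sg i I * x) = x"
  by (simp add: sg_sq flip: mult.assoc)

lemma sg_insert: "j \<notin> I \<Longrightarrow> sg i (insert j I) = (if j < i then - sg i I else sg i I)"
proof -
  assume "j \<notin> I"
  have "{k \<in> insert j I. k < i} = (if j < i then insert j {k\<in>I. k < i} else {k\<in>I. k < i})"
    by auto
  then show ?thesis using \<open>j \<notin> I\<close> by (simp add: sg_def)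
qed

lemma sg_remove: "j \<in> I \<Longrightarrow> sg i (I - {j}) = (if j < i then - sg i I else sg i I)"
proof -
  assume "j \<in> I"
  then have "sg i I = (if j < i then - sg i (I - {j}) else sg i (I - {j}) :: 'b)"
    using sg_insert[of j "I - {j}" i] by (simp add: insert_absorb)
  then show ?thesis by simp
qed

text \<open>
  A function \<open>u\<close> on pairs \<open>(I, q)\<close> stands for \<open>\<Sum> u(I,q) e\<^sub>I t\<^sup>(\<^sup>q\<^sup>)\<close>. Then \<open>ann i\<close> is the contraction by \<open>i\<close>,
  \<open>shift p\<close> lowers the divided power by \<open>p\<close>, and \<open>cre i\<close> is \<open>e\<^sub>i \<and>\<close> composed with \<open>shift 1\<close>.
\<close>

definition ann :: "'n::{finite,linorder} \<Rightarrow> ('n set \<times> nat \<Rightarrow> 'r::comm_ring_1) \<Rightarrow> 'n set \<times> nat \<Rightarrow> 'r" where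
  "ann i u = (\<lambda>(I, q). if i \<in> I then 0 else sg i I * u (insert i I, q))"

definition cre :: "'n::{finite,linorder} \<Rightarrow> ('n set \<times> nat \<Rightarrow> 'r::comm_ring_1) \<Rightarrow> 'n set \<times> nat \<Rightarrow> 'r" where
  "cre i u = (\<lambda>(I, q). if i \<in> I then sg i I * u (I - {i}, Suc q) else 0)"

definition shift :: "nat \<Rightarrow> ('n set \<times> nat \<Rightarrow> 'r) \<Rightarrow> 'n set \<times> nat \<Rightarrow> 'r" where
  "shift p u = (\<lambda>(I, q). u (I, q + p))"

text \<open>The differential over \<open>A^e\<close>, its lift to \<open>A[y]\<close> and the
  operators \<open>X_i\<close> all have this form, so one calculus serves them all.\<close>

definition cliff ::
  "('n::{finite,linorder} \<Rightarrow> 'r::comm_ring_1) \<Rightarrow> ('n \<Rightarrow> 'r) \<Rightarrow> ('n set \<times> nat \<Rightarrow> 'r) \<Rightarrow> 'n set \<times> nat \<Rightarrow> 'r" where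
  "cliff a b u = (\<lambda>x. \<Sum>i\<in>UNIV. a i * ann i u x + b i * cre i u x)"

lemma ann_ann: "ann i (ann j u) x + ann j (ann i u) x = 0"
  by (cases x; cases "i = j"; cases i j rule: linorder_cases)
    (auto simp: ann_def sg_insert insert_commute)

lemma cre_cre: "cre i (cre j u) x + cre j (cre i u) x = 0"
  by (cases x; cases "i = j"; cases i j rule: linorder_cases)
    (auto simp: cre_def sg_remove insert_commute Diff_insert[symmetric])

text \<open>A Clifford relation, with \<open>shift 1\<close> in place of the identity because
  \<open>cre\<close> also lowers the divided power.\<close>

lemma ann_cre: "ann i (cre j u) x + cre j (ann i u) x = (if i = j then shift 1 u x else 0)"
proof (cases "i = j")
  case True
  then show ?thesis
    by (cases x) (auto simp: ann_def cre_def shift_def sg_insert sg_remove insert_absorb sg_sq_left)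
next
  case False
  then show ?thesis
    by (cases x; cases i j rule: linorder_cases)
      (auto simp: ann_def cre_def shift_def sg_insert sg_remove insert_Diff_if)
qed

lemma ann_add: "ann i (\<lambda>x. u x + v x) x = ann i u x + ann i v x"
  by (cases x) (simp add: ann_def algebra_simps)

lemma cre_add: "cre i (\<lambda>x. u x + v x) x = cre i u x + cre i v x"
  by (cases x) (simp add: cre_def algebra_simps)

lemma ann_mult: "ann i (\<lambda>x. c * u x) x = c * ann i u x"
  by (cases x) (simp add: ann_def algebra_simps)

lemma cre_mult: "cre i (\<lambda>x. c * u x) x = c * cre i u x"
  by (cases x) (simp add: cre_def algebra_simps)

lemma ann_zero: "ann i (\<lambda>x. 0) x = 0"
  by (cases x) (simp add: ann_def)

lemma cre_zero: "cre i (\<lambda>x. 0) x = 0"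
  by (cases x) (simp add: cre_def)

lemma ann_sum: "ann i (\<lambda>x. \<Sum>j\<in>S. u j x) x = (\<Sum>j\<in>S. ann i (u j) x)"
  by (cases x) (simp add: ann_def sum_distrib_left)

lemma cre_sum: "cre i (\<lambda>x. \<Sum>j\<in>S. u j x) x = (\<Sum>j\<in>S. cre i (u j) x)"
  by (cases x) (simp add: cre_def sum_distrib_left)

text \<open>With the order of summation exchanged in one double sum, the terms for each pair
  \<open>i\<close>, \<open>j\<close> combine by the Clifford relations, and only the diagonal
  survives.\<close>

lemma cliff_anticomm:
  fixes a b a' b' :: "'n::{finite,linorder} \<Rightarrow> 'r::comm_ring_1"
  shows "cliff a b (cliff a' b' u) x + cliff a' b' (cliff a b u) x
    = (\<Sum>i\<in>UNIV. a i * b' i + a' i * b i) * shift 1 u x"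
proof -
  have expand: "cliff a b (cliff a' b' u) x =
     (\<Sum>i\<in>UNIV. \<Sum>j\<in>UNIV. a i * a' j * ann i (ann j u) x + a i * b' j * ann i (cre j u) x
       + b i * a' j * cre i (ann j u) x + b i * b' j * cre i (cre j u) x)" for a b a' b' :: "'n \<Rightarrow> 'r"
    unfolding cliff_def
    by (rule sum.cong) (simp_all add: ann_sum cre_sum ann_add cre_add ann_mult cre_mult
        sum_distrib_left algebra_simps sum.distrib)
  have swap: "cliff a' b' (cliff a b u) x =
     (\<Sum>i\<in>UNIV. \<Sum>j\<in>UNIV. a' j * a i * ann j (ann i u) x + a' j * b i * ann j (cre i u) x
       + b' j * a i * cre j (ann i u) x + b' j * b i * cre j (cre i u) x)"
    unfolding expand by (rule sum.swap)
  have pointwise: "(a i * a' j * ann i (ann j u) x + a i * b' j * ann i (cre j u) x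
       + b i * a' j * cre i (ann j u) x + b i * b' j * cre i (cre j u) x) +
      (a' j * a i * ann j (ann i u) x + a' j * b i * ann j (cre i u) x
       + b' j * a i * cre j (ann i u) x + b' j * b i * cre j (cre i u) x)
      = (if i = j then (a i * b' j + a' j * b i) * shift 1 u x else 0)" for i j
  proof -
    have "(a i * a' j * ann i (ann j u) x + a i * b' j * ann i (cre j u) x
       + b i * a' j * cre i (ann j u) x + b i * b' j * cre i (cre j u) x) +
      (a' j * a i * ann j (ann i u) x + a' j * b i * ann j (cre i u) x
       + b' j * a i * cre j (ann i u) x + b' j * b i * cre j (cre i u) x)
      = a i * a' j * (ann i (ann j u) x + ann j (ann i u) x)
       + a i * b' j * (ann i (cre j u) x + cre j (ann i u) x)
       + b i * a' j * (ann j (cre i u) x + cre i (ann j u) x)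
       + b i * b' j * (cre i (cre j u) x + cre j (cre i u) x)"
      by (simp add: algebra_simps)
    also have "\<dots> = (if i = j then (a i * b' j + a' j * b i) * shift 1 u x else 0)"
      by (simp only: ann_ann cre_cre ann_cre) (auto simp: algebra_simps)
    finally show ?thesis .
  qed
  show ?thesis
    unfolding expand[of a b a' b'] swap sum.distrib[symmetric] pointwise
    by (simp add: sum_distrib_right)
qed

lemma cliff_shift: "cliff a b (shift p u) = shift p (cliff a b u)"
  by (rule ext) (auto simp: cliff_def ann_def cre_def shift_def intro!: sum.cong)

lemma cliff_add: "cliff a b (\<lambda>x. u x + v x) x = cliff a b u x + cliff a b v x"
  by (simp add: cliff_def ann_add cre_add algebra_simps sum.distrib)

lemma cliff_mult: "cliff a b (\<lambda>x. c * u x) x = c * cliff a b u x"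
  by (simp add: cliff_def ann_mult cre_mult sum_distrib_left algebra_simps)

lemma cliff_sum: "cliff a b (\<lambda>x. \<Sum>j\<in>S. u j x) x = (\<Sum>j\<in>S. cliff a b (u j) x)"
  unfolding cliff_def ann_sum cre_sum by (simp add: sum_distrib_left sum.distrib sum.swap[of _ S])

lemma cliff_diff: "cliff a b (\<lambda>x. u x - v x) x = cliff a b u x - cliff a b v x"
  using cliff_add[of a b u "\<lambda>x. (-1) * v x" x] cliff_mult[of a b "-1" v x] by simp

lemma cliff_zero: "cliff a b (\<lambda>x. 0) x = 0"
  by (simp add: cliff_def ann_zero cre_zero)

text \<open>Serves to pass from \<open>A[y]\<close> to \<open>A^e\<close> along \<open>penv\<close>
  and from \<open>A^e\<close> to \<open>A\<close> along \<open>eps\<close>.\<close>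

lemma cliff_hom:
  fixes h :: "'r::comm_ring_1 \<Rightarrow> 's::comm_ring_1" and a b :: "'n::{finite,linorder} \<Rightarrow> 'r"
  assumes "h 0 = 0" "\<And>x y. h (x + y) = h x + h y" "\<And>x y. h (x * y) = h x * h y" "h 1 = 1"
  shows "h (cliff a b u x) = cliff (h \<circ> a) (h \<circ> b) (h \<circ> u) x"
proof -
  have neg: "h (- x) = - h x" for x
    using assms(2)[of x "-x"] assms(1) by (simp add: add_eq_0_iff)
  have pow: "h (sg i I) = sg i I" for i :: 'n and I
    by (cases "even (card {k\<in>I. k < i})") (simp_all add: sg_def neg assms(4))
  have sum: "h (sum g S) = (\<Sum>i\<in>S. h (g i))" for g :: "'n \<Rightarrow> 'r" and S
    by (induction S rule: infinite_finite_induct) (simp_all add: assms)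
  show ?thesis
    by (cases x) (auto simp: cliff_def sum assms(1,2,3) ann_def cre_def pow intro!: sum.cong)
qed

definition supp :: "nat \<Rightarrow> ('n::finite set \<times> nat \<Rightarrow> 'r::zero) \<Rightarrow> bool" where
  "supp m u \<longleftrightarrow> (\<forall>I q. card I + 2 * q \<noteq> m \<longrightarrow> u (I, q) = 0)"

lemma suppD: "supp m u \<Longrightarrow> card I + 2 * q \<noteq> m \<Longrightarrow> u (I, q) = 0"
  by (simp add: supp_def)

text \<open>Both kinds of summand lower the degree by one: contraction removes an exterior factor,
  while \<open>cre\<close> trades a divided power of degree 2 for an exterior factor.\<close>

lemma supp_cliff:
  assumes u: "supp (Suc m) u"
  shows "supp m (cliff a b u)"
proof -
  have "a i * ann i u (I, q) + b i * cre i u (I, q) = 0" if ne: "card I + 2 * q \<noteq> m" for i I q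
  proof (cases "i \<in> I")
    case True
    then have "card I = Suc (card (I - {i}))" by (intro card.remove) auto
    then have "card (I - {i}) + 2 * Suc q \<noteq> Suc m" using ne by presburger
    then show ?thesis using True suppD[OF u] by (simp add: ann_def cre_def)
  next
    case False
    then have "card (insert i I) + 2 * q \<noteq> Suc m" using ne by simp
    then show ?thesis using False suppD[OF u] by (simp add: ann_def cre_def)
  qed
  then show ?thesis unfolding supp_def cliff_def by (intro allI impI sum.neutral ballI)
qed

lemma supp_0_cliff: "supp 0 u \<Longrightarrow> cliff a b u x = 0"
  by (cases x) (auto simp: suppD cliff_def ann_def cre_def intro!: sum.neutral)

lemma supp_shift: "supp (m + 2 * p) u \<Longrightarrow> supp m (shift p u)"
  by (auto simp: supp_def shift_def)

text \<open>Each summand is the difference of two mixed products that switch from \<open>x\<close>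
  to \<open>y\<close> at consecutive places. The induction removes the least element, so that what
  remains is again closed upwards.\<close>

lemma telescope:
  fixes x y :: "'n::{finite,linorder} \<Rightarrow> 'r::comm_ring_1"
  assumes "finite S" "\<And>i j. i \<in> S \<Longrightarrow> i < j \<Longrightarrow> j \<in> S"
  shows "(\<Sum>j\<in>S. (\<Prod>l\<in>{..<j}. x l) * (\<Prod>l\<in>{j<..}. y l) * (y j - x j))
    = (\<Prod>l\<in>-S. x l) * (\<Prod>l\<in>S. y l) - (\<Prod>l\<in>UNIV. x l)"
  using assms
proof (induction S rule: finite_linorder_min_induct)
  case empty
  then show ?case by simp
next
  case (insert b S)
  have S: "S = {b<..}" using insert by force
  have up: "-S = insert b {..<b}" "- insert b S = {..<b}" using S by auto
  have "(\<Sum>j\<in>S. (\<Prod>l\<in>{..<j}. x l) * (\<Prod>l\<in>{j<..}. y l) * (y j - x j))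
    = (\<Prod>l\<in>-S. x l) * (\<Prod>l\<in>S. y l) - (\<Prod>l\<in>UNIV. x l)"
    by (rule insert.IH) (use S in auto)
  then show ?case unfolding up using S by (simp add: algebra_simps)
qed

section \<open>Koszul complexes and hypersurface quotients\<close>

lemma sum_antisym_eq_0:
  fixes g :: "'n::{finite,linorder} \<Rightarrow> 'n \<Rightarrow> 'r::comm_ring_1"
  assumes "\<And>i. g i i = 0" "\<And>i j. g i j + g j i = 0"
  shows "(\<Sum>i\<in>UNIV. \<Sum>j\<in>UNIV. g i j) = 0"
proof -
  have "(\<Sum>i\<in>UNIV. \<Sum>j\<in>UNIV. g i j)
      = (\<Sum>i\<in>UNIV. \<Sum>j\<in>UNIV. (if i < j then g i j else 0) + (if j < i then g i j else 0))"
    using assms(1) by (intro sum.cong refl) (metis add_0 add_0_right linorder_neqE order_less_asym)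
  also have "\<dots> = (\<Sum>i\<in>UNIV. \<Sum>j\<in>UNIV. if i < j then g i j else 0)
      + (\<Sum>i\<in>UNIV. \<Sum>j\<in>UNIV. if j < i then g i j else 0)"
    by (simp add: sum.distrib)
  also have "(\<Sum>i\<in>UNIV. \<Sum>j\<in>UNIV. if j < i then g i j else 0)
      = (\<Sum>i\<in>UNIV. \<Sum>j\<in>UNIV. if i < j then g j i else 0)"
    by (rule sum.swap)
  finally show ?thesis
    using assms(2) by (simp add: sum.distrib[symmetric] if_distrib[of "\<lambda>x. x + _"] cong: if_cong)
qed

text \<open>In characteristic 2 this does not follow from \<open>cliff_anticomm\<close>.\<close>

lemma cliff_sq: "cliff a b (cliff a b u) x = (\<Sum>i\<in>UNIV. a i * b i) * shift 1 u x"
proof -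
  \<comment> \<open>Subtracting the expected result on the diagonal makes \<open>g\<close>
    alternating, so its double sum vanishes without dividing by 2.\<close>
  define g where "g i j = a i * a j * ann i (ann j u) x + a i * b j * ann i (cre j u) x
       + b i * a j * cre i (ann j u) x + b i * b j * cre i (cre j u) x
       - (if i = j then a i * b i * shift 1 u x else 0)" for i j
  have sq: "ann i (ann i u) x = 0" "cre i (cre i u) x = 0" for i
    by (cases x, simp add: ann_def cre_def)+
  have "g i i = a i * b i * (ann i (cre i u) x + cre i (ann i u) x) - a i * b i * shift 1 u x" for i
    by (simp add: g_def sq algebra_simps)
  then have diag: "g i i = 0" for i
    by (simp add: ann_cre)
  have "g i j + g j i = 0" for i j
  proof (cases "i = j")
    case False
    then have "g i j + g j i = a i * a j * (ann i (ann j u) x + ann j (ann i u) x)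
       + a i * b j * (ann i (cre j u) x + cre j (ann i u) x)
       + b i * a j * (ann j (cre i u) x + cre i (ann j u) x)
       + b i * b j * (cre i (cre j u) x + cre j (cre i u) x)"
      by (simp add: g_def algebra_simps)
    also have "\<dots> = 0"
      using False by (simp only: ann_ann cre_cre ann_cre) simp
    finally show ?thesis .
  qed (simp add: diag)
  with diag have "(\<Sum>i\<in>UNIV. \<Sum>j\<in>UNIV. g i j) = 0"
    by (intro sum_antisym_eq_0)
  moreover have "cliff a b (cliff a b u) x =
     (\<Sum>i\<in>UNIV. \<Sum>j\<in>UNIV. a i * a j * ann i (ann j u) x + a i * b j * ann i (cre j u) x
       + b i * a j * cre i (ann j u) x + b i * b j * cre i (cre j u) x)"
    unfolding cliff_def
    by (rule sum.cong) (simp_all add: ann_sum cre_sum ann_add cre_add ann_mult cre_mult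
        sum_distrib_left algebra_simps sum.distrib)
  ultimately show ?thesis
    by (simp add: g_def sum_subtractf sum_distrib_right)
qed

text \<open>\<open>e\<^sub>j \<and> Q\<^sub>j\<close>, a contracting homotopy for the Koszul complex of \<open>\<theta>\<^sub>j\<close> alone when \<open>Q\<^sub>j\<close> divides by \<open>\<theta>\<^sub>j\<close>.\<close>

definition dquot :: "('n::{finite,linorder} \<Rightarrow> 'r \<Rightarrow> 'r) \<Rightarrow> 'n \<Rightarrow>
    ('n set \<times> nat \<Rightarrow> 'r::comm_ring_1) \<Rightarrow> 'n set \<times> nat \<Rightarrow> 'r" where
  "dquot Q j u = (\<lambda>(I, q). if j \<in> I then sg j I * Q j (u (I - {j}, q)) else 0)"

text \<open>\<open>Q j\<close> is division by \<open>\<theta> j\<close>, with remainder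
  \<open>x - \<theta> j * Q j x\<close>, and commutes with multiplication by the other
  \<open>\<theta> i\<close>. This is regularity of the sequence in the form of explicit
  homotopies.\<close>

locale koszul =
  fixes \<theta> c :: "'n::{finite,linorder} \<Rightarrow> 'r::comm_ring_1" and Q :: "'n \<Rightarrow> 'r \<Rightarrow> 'r"
  assumes Q_add: "Q j (x + y) = Q j x + Q j y"
    and Q_same: "Q j (\<theta> j * x) = x"
    and Q_other: "i \<noteq> j \<Longrightarrow> Q j (\<theta> i * x) = \<theta> i * Q j x"
begin

lemma Q_0: "Q j 0 = 0"
  using Q_add[of j 0 0] by simp

lemma Q_neg: "Q j (- x) = - Q j x"
  using Q_add[of j x "- x"] by (simp add: Q_0 add_eq_0_iff)

lemma Q_sum: "Q j (sum g S) = (\<Sum>i\<in>S. Q j (g i))"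
  by (induction S rule: infinite_finite_induct) (simp_all add: Q_0 Q_add)

lemma Q_sg: "Q j (sg i I * x) = sg i I * Q j x"
  by (cases "even (card {k\<in>I. k < i})") (simp_all add: sg_def Q_neg)

text \<open>One summand of the homotopy formula. For \<open>i \<noteq> j\<close> the two terms
  cancel because the signs are opposite; for \<open>i = j\<close> only one of them occurs, depending
  on whether \<open>j \<in> I\<close>.\<close>

lemma ann_dquot:
  "\<theta> i * ann i (dquot Q j u) (I, q)
      + (if j \<in> I then sg j I * Q j (\<theta> i * ann i u (I - {j}, q)) else 0)
    = (if i = j then (if j \<in> I then u (I, q) else \<theta> j * Q j (u (I, q))) else 0)"
proof (cases "i = j")
  case True
  then show ?thesis
    by (auto simp: ann_def dquot_def Q_same Q_0 sg_sq_left sg_remove sg_insert insert_absorb)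
next
  case False
  consider "i \<in> I" | "i \<notin> I" "j \<notin> I" | "i \<notin> I" "j \<in> I" by blast
  then show ?thesis
  proof cases
    case 1
    then show ?thesis using False by (simp add: ann_def Q_0)
  next
    case 2
    then show ?thesis using False by (simp add: ann_def dquot_def)
  next
    case 3
    then have eq: "insert i I - {j} = insert i (I - {j})" using False by auto
    have "i < j \<or> j < i" using False by auto
    then show ?thesis
      using False 3
      by (auto simp: ann_def dquot_def eq Q_neg Q_sg Q_other sg_insert sg_remove mult.left_commute)
  qed
qed

text \<open>So \<open>dquot Q j\<close> is a homotopy from the identity to the projection onto
  remainders in the part without \<open>e_j\<close>. Concentration in \<open>q = 0\<close> removes
  the \<open>cre\<close> terms.\<close>

lemma cliff_dquot:
  assumes "\<And>I q. u (I, Suc q) = 0"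
  shows "cliff \<theta> c (dquot Q j u) (I, q) + dquot Q j (cliff \<theta> c u) (I, q)
    = u (I, q) - (if j \<in> I then 0 else u (I, q) - \<theta> j * Q j (u (I, q)))"
proof -
  have cliff: "cliff \<theta> c v x = (\<Sum>i\<in>UNIV. \<theta> i * ann i v x)" if "\<And>I q. v (I, Suc q) = 0" for v x
    by (cases x) (simp add: cliff_def cre_def that cong: if_cong)
  have v: "dquot Q j u (I, Suc q) = 0" for I q
    by (simp add: dquot_def assms Q_0)
  have "dquot Q j (cliff \<theta> c u) (I, q)
    = (\<Sum>i\<in>UNIV. if j \<in> I then sg j I * Q j (\<theta> i * ann i u (I - {j}, q)) else 0)"
    by (simp add: dquot_def cliff[of u, OF assms] Q_sum sum_distrib_left)
  then show ?thesis
    by (simp add: cliff[of "dquot Q j u", OF v] sum.distrib[symmetric] ann_dquot)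
qed

text \<open>Only indices in \<open>S\<close> occur in \<open>b\<close>. Subtracting the boundary of
  \<open>dquot Q j b\<close> eliminates the index \<open>j\<close>; once no index is left, positive
  degree forces \<open>b = 0\<close>.\<close>

lemma koszul_exact_aux:
  assumes "finite S" "supp (Suc m) b" "\<And>x. cliff \<theta> c b x = 0" "\<And>I q. b (I, Suc q) = 0"
    and "\<And>I q. \<not> I \<subseteq> S \<Longrightarrow> b (I, q) = 0"
  shows "\<exists>u. supp (m + 2) u \<and> cliff \<theta> c u = b"
  using assms
proof (induction S arbitrary: b)
  case empty
  have "b (I, q) = 0" for I q
    using empty.prems(4)[of I q] empty.prems(3) suppD[OF empty.prems(1), of "{}" 0]
    by (cases q) auto
  then have "b = (\<lambda>x. 0)" by auto
  then show ?case
    by (intro exI[of _ "\<lambda>x. 0"]) (simp add: supp_def cliff_zero fun_eq_iff)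
next
  case (insert j S)
  have s: "supp (m + 2) (dquot Q j b)"
    unfolding supp_def
  proof (intro allI impI)
    fix I :: "'n set" and q
    assume ne: "card I + 2 * q \<noteq> m + 2"
    show "dquot Q j b (I, q) = 0"
    proof (cases "j \<in> I")
      case True
      then have "card I = Suc (card (I - {j}))" by (intro card.remove) auto
      then have "card (I - {j}) + 2 * q \<noteq> Suc m" using ne by linarith
      then have "b (I - {j}, q) = 0" by (rule suppD[OF insert.prems(1)])
      then show ?thesis by (simp add: dquot_def Q_0)
    qed (simp add: dquot_def)
  qed
  define b' where "b' = (\<lambda>x. b x - cliff \<theta> c (dquot Q j b) x)"
  have b': "b' (I, q) = (if j \<in> I then 0 else b (I, q) - \<theta> j * Q j (b (I, q)))" for I q
  proof -
    have "cliff \<theta> c b = (\<lambda>x. 0)" using insert.prems(2) by auto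
    then have "dquot Q j (cliff \<theta> c b) (I, q) = 0"
      by (simp add: dquot_def Q_0)
    then show ?thesis
      using cliff_dquot[of b j I q] insert.prems(3) by (simp add: b'_def)
  qed
  have "\<exists>u. supp (m + 2) u \<and> cliff \<theta> c u = b'"
  proof (rule insert.IH)
    have "supp (Suc m) (cliff \<theta> c (dquot Q j b))"
      using s by (intro supp_cliff) simp
    then show "supp (Suc m) b'"
      using insert.prems(1) by (simp add: supp_def b'_def)
    show "cliff \<theta> c b' x = 0" for x
      by (cases x) (simp add: b'_def cliff_diff insert.prems(2) cliff_sq shift_def dquot_def
          insert.prems(3) Q_0)
    show "b' (I, Suc q) = 0" for I q
      by (simp add: b' insert.prems(3) Q_0)
    show "b' (I, q) = 0" if "\<not> I \<subseteq> S" for I q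
      using that insert.prems(4)[of I q] by (cases "j \<in> I") (simp_all add: b' Q_0 subset_insert)
  qed
  then obtain u where u: "supp (m + 2) u" "cliff \<theta> c u = b'" by blast
  have "cliff \<theta> c (\<lambda>x. u x + dquot Q j b x) = b"
    by (rule ext) (simp add: cliff_add u(2) b'_def)
  moreover have "supp (m + 2) (\<lambda>x. u x + dquot Q j b x)"
    using u(1) s by (simp add: supp_def)
  ultimately show ?case by blast
qed

end

text \<open>Here \<open>h\<close> is the passage to the hypersurface quotient by the nonzerodivisor
  \<open>f\<close>. Over \<open>'r\<close> the lifted operator \<open>cliff \<theta> c\<close>
  squares to \<open>f\<close> times \<open>shift 1\<close>, not to zero.\<close>

locale koszul_quotient = koszul \<theta> c Q
  for \<theta> c :: "'n::{finite,linorder} \<Rightarrow> 'r::comm_ring_1" and Q +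
  fixes f :: 'r and h :: "'r \<Rightarrow> 's::comm_ring_1"
  assumes f_sum: "(\<Sum>i\<in>UNIV. \<theta> i * c i) = f"
    and f_reg: "f * x = 0 \<Longrightarrow> x = 0"
    and h_0: "h 0 = 0" and h_1: "h 1 = 1" and h_add: "h (x + y) = h x + h y"
    and h_mult: "h (x * y) = h x * h y"
    and h_surj: "\<exists>x. h x = w"
    and h_ker: "h x = 0 \<Longrightarrow> f dvd x"
begin

text \<open>A cycle lifts to some \<open>z'\<close> whose image under the lifted operator is
  \<open>f * w\<close>. Comparing with the square of the operator and cancelling \<open>f\<close>
  shows that \<open>w\<close> is mapped to \<open>shift 1 z'\<close>, so \<open>w\<close> supplies
  the part of a preimage with positive \<open>q\<close>.\<close>

lemma exact_Suc:
  assumes z: "supp (Suc m) z" "\<And>x. cliff (h \<circ> \<theta>) (h \<circ> c) z x = 0"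
  shows "\<exists>u. supp (m + 2) u \<and> cliff (h \<circ> \<theta>) (h \<circ> c) u = z"
proof -
  let ?D = "cliff \<theta> c"
  have h_cliff: "h (?D u x) = cliff (h \<circ> \<theta>) (h \<circ> c) (h \<circ> u) x" for u x
    by (rule cliff_hom) (simp_all add: h_0 h_1 h_add h_mult)
  \<comment> \<open>Zero coefficients are lifted to zero to keep the lift homogeneous;
    \<open>w\<close> is chosen in the same way below.\<close>
  have "\<exists>y. h y = z x \<and> (z x = 0 \<longrightarrow> y = 0)" for x
    using h_surj[of "z x"] h_0 by metis
  then obtain z' where z': "\<And>x. h (z' x) = z x" "\<And>x. z x = 0 \<Longrightarrow> z' x = 0"
    by metis
  have sz': "supp (Suc m) z'"
    using z(1) z'(2) by (simp add: supp_def)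
  have hz': "h \<circ> z' = z" using z'(1) by auto
  have "h (?D z' x) = 0" for x
    by (simp add: h_cliff hz' z(2))
  then have "\<exists>y. ?D z' x = f * y \<and> (?D z' x = 0 \<longrightarrow> y = 0)" for x
    using h_ker[of "?D z' x"] by (metis dvdE mult_zero_right)
  then obtain w where w: "\<And>x. ?D z' x = f * w x" "\<And>x. ?D z' x = 0 \<Longrightarrow> w x = 0"
    by metis
  have sw: "supp m w"
    using supp_cliff[OF sz', of \<theta> c] w(2) by (simp add: supp_def)
  have Dz': "?D z' = (\<lambda>x. f * w x)" using w(1) by auto
  have Dw: "?D w x = shift 1 z' x" for x
  proof -
    have "f * ?D w x = f * shift 1 z' x"
      using cliff_sq[of \<theta> c z' x] unfolding Dz' cliff_mult f_sum .
    then have "f * (?D w x - shift 1 z' x) = 0"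
      by (simp add: algebra_simps)
    then have "?D w x - shift 1 z' x = 0" by (rule f_reg)
    then show ?thesis by simp
  qed
  txt \<open>Subtracting the boundary of \<open>t\<close>, which is \<open>w\<close> moved up by one divided power, leaves a Koszul cycle
    concentrated in \<open>q = 0\<close>.\<close>
  define t where "t = (\<lambda>(I, q). case q of 0 \<Rightarrow> 0 | Suc q' \<Rightarrow> w (I, q'))"
  have st: "supp (m + 2) t"
    using sw by (auto simp: supp_def t_def split: nat.split)
  have shift_t: "shift (Suc 0) t = w"
    by (auto simp: shift_def t_def)
  define b where "b = (\<lambda>x. z' x - ?D t x)"
  have "\<exists>u. supp (m + 2) u \<and> ?D u = b"
  proof (rule koszul_exact_aux[of UNIV])
    have "supp (Suc m) (?D t)"
      using st by (intro supp_cliff) simp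
    then show "supp (Suc m) b"
      using sz' by (simp add: supp_def b_def)
    show "?D b x = 0" for x
      by (simp add: b_def cliff_diff Dz' cliff_sq f_sum shift_t)
    \<comment> \<open>The operator commutes with \<open>shift 1\<close>, so the part of
      \<open>?D t\<close> with positive \<open>q\<close> is given by \<open>?D w\<close>, which is
      \<open>shift 1 z'\<close>.\<close>
    show "b (I, Suc q) = 0" for I q
    proof -
      have "?D t (I, Suc q) = shift 1 (?D t) (I, q)" by (simp add: shift_def)
      also have "\<dots> = shift 1 z' (I, q)" by (simp only: cliff_shift[symmetric] One_nat_def shift_t Dw[unfolded One_nat_def])
      finally show ?thesis by (simp add: b_def shift_def)
    qed
  qed auto
  then obtain u where u: "supp (m + 2) u" "?D u = b" by blast
  have "?D (\<lambda>x. u x + t x) = z'"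
    by (rule ext) (simp add: cliff_add u(2) b_def)
  then have "cliff (h \<circ> \<theta>) (h \<circ> c) (h \<circ> (\<lambda>x. u x + t x)) = z"
    using h_cliff[of "\<lambda>x. u x + t x"] z'(1) by (intro ext) metis
  moreover have "supp (m + 2) (h \<circ> (\<lambda>x. u x + t x))"
    using u(1) st by (simp add: supp_def h_0)
  ultimately show ?thesis by blast
qed

end

section \<open>The algebras \<open>A\<close> and \<open>A\<^sup>e\<close>\<close>

abbreviation single where "single \<equiv> Poly_Mapping.single"
abbreviation lookup where "lookup \<equiv> Poly_Mapping.lookup"
abbreviation keys where "keys \<equiv> Poly_Mapping.keys"

section \<open>Coefficients and divisibility by monomials\<close>

lemma poly_mapping_decomp: "u = (\<Sum>\<beta>\<in>keys u. single \<beta> (lookup u \<beta>))"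
  by (rule poly_mapping_eqI) (simp add: lookup_sum lookup_single when_def in_keys_iff)

lemma poly_mapping_induct [case_names zero single add]:
  fixes P :: "('a \<Rightarrow>\<^sub>0 'b::comm_monoid_add) \<Rightarrow> bool"
  assumes "P 0" "\<And>s c. P (single s c)" "\<And>u v. P u \<Longrightarrow> P v \<Longrightarrow> P (u + v)"
  shows "P u"
proof -
  have "P (\<Sum>\<beta>\<in>S. single \<beta> (lookup u \<beta>))" for S
    by (induction S rule: infinite_finite_induct) (simp_all add: assms)
  then show ?thesis
    by (metis poly_mapping_decomp)
qed

lemma lookup_single_times_add:
  fixes \<alpha> :: "'a::cancel_comm_monoid_add" and c :: "'b::comm_semiring_1"
  shows "lookup (single \<alpha> c * u) (\<alpha> + \<beta>) = c * lookup u \<beta>"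
  by (induction u rule: poly_mapping_induct)
    (auto simp: mult_single lookup_single when_def lookup_add distrib_left)

lemma lookup_single_times_eq_0:
  fixes \<alpha> :: "'a::cancel_comm_monoid_add" and c :: "'b::comm_semiring_1"
  assumes "\<And>\<gamma>. \<beta> \<noteq> \<alpha> + \<gamma>"
  shows "lookup (single \<alpha> c * u) \<beta> = 0"
  by (induction u rule: poly_mapping_induct)
    (use assms in \<open>auto simp: mult_single lookup_single when_def lookup_add distrib_left\<close>)

lemma exponent_split:
  fixes \<alpha> \<beta> :: "'n \<Rightarrow>\<^sub>0 nat"
  assumes "\<And>i. lookup \<alpha> i \<le> lookup \<beta> i"
  shows "\<beta> = \<alpha> + (\<beta> - \<alpha>)"
  by (rule poly_mapping_eqI) (simp add: lookup_add lookup_minus assms)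

lemma single_dvd:
  fixes u :: "('n \<Rightarrow>\<^sub>0 nat) \<Rightarrow>\<^sub>0 'b::comm_semiring_1"
  assumes "\<And>\<beta> i. \<beta> \<in> keys u \<Longrightarrow> lookup \<alpha> i \<le> lookup \<beta> i"
  shows "single \<alpha> 1 dvd u"
proof -
  have "single \<alpha> 1 dvd (\<Sum>\<beta>\<in>keys u. single \<beta> (lookup u \<beta>))"
  proof (rule dvd_sum)
    fix \<beta> assume "\<beta> \<in> keys u"
    then have "\<beta> = \<alpha> + (\<beta> - \<alpha>)" by (intro exponent_split assms)
    then have "single \<beta> (lookup u \<beta>) = single \<alpha> 1 * single (\<beta> - \<alpha>) (lookup u \<beta>)"
      by (simp add: mult_single)
    then show "single \<alpha> 1 dvd single \<beta> (lookup u \<beta>)" by (rule dvdI)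
  qed
  then show ?thesis
    by (simp flip: poly_mapping_decomp)
qed

definition expo :: "'n::finite set \<Rightarrow> 'n \<Rightarrow>\<^sub>0 nat" where
  "expo S = (\<Sum>i\<in>S. single i 1)"

lemma lookup_expo: "lookup (expo S) i = (if i \<in> S then 1 else 0)"
  by (simp add: expo_def lookup_sum lookup_single when_def)

lemma prod_single: "(\<Prod>i\<in>S. single (g i) (h i)) = single (\<Sum>i\<in>S. g i) (\<Prod>i\<in>S. h i)"
  by (induction S rule: infinite_finite_induct) (simp_all add: mult_single)

lemma pvar_prod_eq: "pvar_prod = single (expo UNIV) 1"
  by (simp add: pvar_prod_def pvar_def pmonom_def prod_single expo_def)

lemma pvar_prod_dvd_lookup:
  assumes "pvar_prod dvd u" "lookup \<beta> i = 0"
  shows "lookup u \<beta> = 0"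
proof -
  obtain v where v: "u = single (expo UNIV) 1 * v"
    using assms(1) by (auto simp: pvar_prod_eq)
  have "\<beta> \<noteq> expo UNIV + \<gamma>" for \<gamma>
  proof
    assume "\<beta> = expo UNIV + \<gamma>"
    then have "lookup \<beta> i \<ge> 1" by (simp add: lookup_add lookup_expo)
    then show False using assms(2) by simp
  qed
  then show ?thesis
    unfolding v by (rule lookup_single_times_eq_0)
qed

lemma pvar_prod_dvdI:
  assumes "\<And>\<beta> i. lookup \<beta> i = 0 \<Longrightarrow> lookup u \<beta> = 0"
  shows "pvar_prod dvd u"
  unfolding pvar_prod_eq
proof (rule single_dvd)
  fix \<beta> i assume "\<beta> \<in> keys u"
  then show "lookup (expo UNIV) i \<le> lookup \<beta> i"
    using assms[of \<beta> i] by (cases "lookup \<beta> i") (auto simp: in_keys_iff lookup_expo)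
qed

text \<open>The coordinates in the monomial basis of \<open>A\<close>. Exponents in which every
  variable occurs get the value 0, because there the coefficient depends on the
  representative.\<close>

lift_definition coef :: "('n::finite \<Rightarrow>\<^sub>0 nat) \<Rightarrow> ('n, 'k::field) alg \<Rightarrow> 'k"
  is "\<lambda>\<beta> u. if \<exists>i. lookup \<beta> i = 0 then lookup u \<beta> else 0"
proof -
  fix \<beta> and u v :: "('n, 'k) mpoly"
  assume "alg_rel u v"
  then have "lookup (u - v) \<beta> = 0" if "lookup \<beta> i = 0" for i
    using that unfolding alg_rel_def by (rule pvar_prod_dvd_lookup)
  then show "(if \<exists>i. lookup \<beta> i = 0 then lookup u \<beta> else 0)
      = (if \<exists>i. lookup \<beta> i = 0 then lookup v \<beta> else 0)"
    by (metis lookup_minus right_minus_eq)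
qed

lemma coef_0: "coef \<beta> 0 = 0" by transfer simp
lemma coef_add: "coef \<beta> (a + b) = coef \<beta> a + coef \<beta> b" by transfer (auto simp: lookup_add simp del: neq0_conv)
lemma coef_aconst_mult: "coef \<beta> (aconst c * a) = c * coef \<beta> a"
  by transfer (simp add: lookup_single_times_add[of 0, simplified] del: neq0_conv)
lemma coef_amonom:
  "\<exists>i. lookup \<beta> i = 0 \<Longrightarrow> coef \<beta> (amonom \<gamma>) = (if \<gamma> = \<beta> then 1 else 0)"
  by transfer (simp only: if_True pmonom_def lookup_single when_def)

lemma alg_eqI:
  assumes "\<And>\<beta>. \<exists>i. lookup \<beta> i = 0 \<Longrightarrow> coef \<beta> a = coef \<beta> b"
  shows "a = b"
  using assms
proof transfer
  fix a b :: "('a, 'b) mpoly"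
  assume *: "\<And>\<beta>. \<exists>i. lookup \<beta> i = 0 \<Longrightarrow> (if \<exists>i. lookup \<beta> i = 0 then lookup a \<beta> else 0)
           = (if \<exists>i. lookup \<beta> i = 0 then lookup b \<beta> else 0)"
  show "alg_rel a b"
    unfolding alg_rel_def
  proof (rule pvar_prod_dvdI)
    fix \<beta> :: "'a \<Rightarrow>\<^sub>0 nat" and i
    assume "lookup \<beta> i = 0"
    then have ex: "\<exists>i. lookup \<beta> i = 0" ..
    from *[OF ex] ex have "lookup a \<beta> = lookup b \<beta>"
      by (simp only: if_True)
    then show "lookup (a - b) \<beta> = 0"
      by (simp add: lookup_minus)
  qed
qed

lemma amonom_0: "amonom 0 = 1"
  by transfer (simp add: pmonom_def alg_rel_def)
lemma amonom_add: "amonom (\<alpha> + \<beta>) = amonom \<alpha> * amonom \<beta>"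
  by transfer (simp add: pmonom_def alg_rel_def mult_single)
lemma avar_eq: "avar i = amonom (single i 1)"
  by transfer (simp add: pvar_def alg_rel_def)
lemma amonom_sum: "amonom (\<Sum>i\<in>S. g i) = (\<Prod>i\<in>S. amonom (g i))"
  by (induction S rule: infinite_finite_induct) (simp_all add: amonom_0 amonom_add)
lemma amonom_expo: "amonom (expo S) = (\<Prod>i\<in>S. avar i)"
  by (simp add: expo_def amonom_sum avar_eq)
lemma prod_avar: "(\<Prod>i\<in>UNIV. avar i) = 0"
  unfolding amonom_expo[symmetric] by transfer (simp add: alg_rel_def pvar_prod_eq pmonom_def)

lemma alg_induct [case_names zero monom add]:
  fixes a :: "('n::finite, 'k::field) alg"
  assumes "P 0" "\<And>c \<beta>. P (aconst c * amonom \<beta>)" "\<And>a b. P a \<Longrightarrow> P b \<Longrightarrow> P (a + b)"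
  shows "P a"
proof -
  have "P (abs_alg u)" for u
  proof (induction u rule: poly_mapping_induct)
    case zero
    then show ?case using assms(1) by (simp add: zero_alg_def)
  next
    case (single \<beta> c)
    have "abs_alg (single \<beta> c) = aconst c * amonom \<beta>"
      by (simp add: aconst.abs_eq amonom.abs_eq times_alg.abs_eq mult_single pmonom_def)
    then show ?case using assms(2) by simp
  next
    case (add u v)
    then show ?case using assms(3) by (simp flip: plus_alg.abs_eq)
  qed
  then show ?thesis
    by (induct a rule: alg.abs_induct)
qed

section \<open>Tensors, the augmentation and coordinates of \<open>A^e\<close> over its left
  factor\<close>

lemma tensor_add_left: "(a + a') \<otimes> b = a \<otimes> b + a' \<otimes> b"
  by transfer (use tensor_ideal.add_left in \<open>simp add: env_rel_def diff_diff_eq\<close>)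
lemma tensor_add_right: "a \<otimes> (b + b') = a \<otimes> b + a \<otimes> b'"
  by transfer (use tensor_ideal.add_right in \<open>simp add: env_rel_def diff_diff_eq\<close>)
lemma tensor_scale: "(aconst c * a) \<otimes> b = a \<otimes> (aconst c * b)"
proof -
  have "(pure_elt (aconst c * a) b - single (Pure a b) c)
     + - (pure_elt a (aconst c * b) - single (Pure a b) c) \<in> tensor_ideal"
    by (intro tensor_ideal.add tensor_ideal_uminus tensor_ideal.scale_left tensor_ideal.scale_right)
  then show ?thesis
    by (simp add: tensor.abs_eq env.abs_eq_iff env_rel_def)
qed
lemma tensor_mult: "(a \<otimes> b) * (c \<otimes> d) = (a * c) \<otimes> (b * d)"
  by transfer (simp add: env_rel_def mult_single tensor_ideal.zero)
lemma tensor_1: "1 \<otimes> 1 = 1"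
  by transfer (simp add: env_rel_def tensor_ideal.zero flip: zero_pure_def)
lemma tensor_0_left: "0 \<otimes> b = 0"
  using tensor_add_left[of 0 0 b] by simp
lemma tensor_0_right: "a \<otimes> 0 = 0"
  using tensor_add_right[of a 0 0] by simp
lemma tensor_prod: "(\<Prod>i\<in>S. g i \<otimes> h i) = (\<Prod>i\<in>S. g i) \<otimes> (\<Prod>i\<in>S. h i)"
  by (induction S rule: infinite_finite_induct) (simp_all add: tensor_1 tensor_mult)

lemma env_induct [case_names zero tensor add]:
  fixes w :: "('n::finite, 'k::field) env"
  assumes "P 0" "\<And>a b. P (a \<otimes> b)" "\<And>v w. P v \<Longrightarrow> P w \<Longrightarrow> P (v + w)"
  shows "P w"
proof -
  have "P (abs_env u)" for u
  proof (induction u rule: poly_mapping_induct)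
    case zero
    then show ?case using assms(1) by (simp add: zero_env_def)
  next
    case (single s c)
    obtain a b where s: "s = Pure a b" by (cases s)
    have "env_rel (pure_elt (aconst c * a) b) (single s c)"
      unfolding env_rel_def s by (rule tensor_ideal.scale_left)
    then have "abs_env (single s c) = (aconst c * a) \<otimes> b"
      by (simp add: tensor.abs_eq env.abs_eq_iff[symmetric])
    then show ?case using assms(2) by simp
  next
    case (add u v)
    then show ?case using assms(3) by (simp flip: plus_env.abs_eq)
  qed
  then show ?thesis
    by (induct w rule: env.abs_induct)
qed

lemma eps_0: "eps 0 = 0" by transfer (rule pure_eps_0)
lemma eps_add: "eps (v + w) = eps v + eps w" by transfer (rule pure_eps_add)
lemma eps_mult: "eps (v * w) = eps v * eps w" by transfer (rule pure_eps_mult)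
lemma eps_tensor: "eps (a \<otimes> b) = a * b"
  by transfer (simp add: pure_eps_single aconst_1)
lemma eps_1: "eps 1 = 1"
  using eps_tensor[of 1 1] by (simp add: tensor_1)
lemma eps_uminus: "eps (- w) = - eps w"
  using eps_add[of w "- w"] by (simp add: eps_0 add_eq_0_iff)
lemma eps_diff: "eps (v - w) = eps v - eps w"
  using eps_add[of v "- w"] by (simp add: eps_uminus)

text \<open>The coefficient of \<open>1 \<otimes> x\<^sup>\<beta>\<close> in the basis of \<open>A\<^sup>e\<close> as a left \<open>A\<close>-module.\<close>

definition pure_coef :: "('n::finite \<Rightarrow>\<^sub>0 nat) \<Rightarrow> ('n, 'k::field) pure_alg \<Rightarrow> ('n, 'k) alg" where
  "pure_coef \<beta> u = (\<Sum>s\<in>keys u. case s of Pure a b \<Rightarrow> aconst (lookup u s * coef \<beta> b) * a)"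

lemma pure_coef_add: "pure_coef \<beta> (u + v) = pure_coef \<beta> u + pure_coef \<beta> v"
  unfolding pure_coef_def
  by (rule setsum_keys_plus_distrib)
    (simp_all add: aconst_0 aconst_add distrib_right split: pure.split)

lemma pure_coef_0: "pure_coef \<beta> 0 = 0"
  by (simp add: pure_coef_def)

lemma pure_coef_uminus: "pure_coef \<beta> (- u) = - pure_coef \<beta> u"
  using pure_coef_add[of \<beta> u "- u"] by (simp add: pure_coef_0 add_eq_0_iff)

lemma pure_coef_diff: "pure_coef \<beta> (u - v) = pure_coef \<beta> u - pure_coef \<beta> v"
  using pure_coef_add[of \<beta> u "- v"] by (simp add: pure_coef_uminus)

lemma pure_coef_single: "pure_coef \<beta> (single (Pure a b) c) = aconst (c * coef \<beta> b) * a"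
  by (cases "c = 0") (simp_all add: pure_coef_def aconst_0)

text \<open>\<open>pure_coef\<close> is not multiplicative, so the induction has to carry an arbitrary factor.\<close>

lemma pure_coef_tensor_ideal: "u \<in> tensor_ideal \<Longrightarrow> pure_coef \<beta> (r * u) = 0"
proof (induction arbitrary: r rule: tensor_ideal.induct)
  case (add_left a a' b)
  show ?case
  proof (induction r rule: poly_mapping_induct)
    case (single s c)
    then show ?case
      by (cases s) (simp add: right_diff_distrib mult_single pure_coef_diff pure_coef_single
          distrib_left)
  qed (simp_all add: pure_coef_0 pure_coef_add distrib_right)
next
  case (add_right a b b')
  show ?case
  proof (induction r rule: poly_mapping_induct)
    case (single s c)
    then show ?case
      by (cases s) (simp add: right_diff_distrib mult_single pure_coef_diff pure_coef_single
          distrib_left coef_add aconst_add distrib_right)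
  qed (simp_all add: pure_coef_0 pure_coef_add distrib_right)
next
  case (scale_left e a b)
  show ?case
  proof (induction r rule: poly_mapping_induct)
    case (single s c)
    then show ?case
      by (cases s) (simp add: right_diff_distrib mult_single pure_coef_diff pure_coef_single
          aconst_mult ac_simps)
  qed (simp_all add: pure_coef_0 pure_coef_add distrib_right)
next
  case (scale_right a e b)
  show ?case
  proof (induction r rule: poly_mapping_induct)
    case (single s c)
    obtain t t' where s: "s = Pure t t'" by (cases s)
    have swap: "t' * (aconst e * b) = aconst e * (t' * b)" by (rule mult.left_commute)
    show ?case
      by (simp add: s swap right_diff_distrib mult_single pure_coef_diff pure_coef_single
          coef_aconst_mult mult.assoc)
  qed (simp_all add: pure_coef_0 pure_coef_add distrib_right)
next
  case zero
  show ?case by (simp add: pure_coef_0)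
next
  case (add u v)
  then show ?case by (simp add: distrib_left pure_coef_add)
next
  case (mult u r')
  show ?case using mult.IH[of "r * r'"] by (simp add: mult.assoc)
qed

lift_definition env_coef :: "('n::finite \<Rightarrow>\<^sub>0 nat) \<Rightarrow> ('n, 'k::field) env \<Rightarrow> ('n, 'k) alg" is pure_coef
  unfolding env_rel_def
  by (drule pure_coef_tensor_ideal[where r = 1]) (simp add: pure_coef_diff)

lemma env_coef_0: "env_coef \<beta> 0 = 0"
  by transfer (rule pure_coef_0)
lemma env_coef_add: "env_coef \<beta> (v + w) = env_coef \<beta> v + env_coef \<beta> w"
  by transfer (rule pure_coef_add)
lemma env_coef_tensor: "env_coef \<beta> (a \<otimes> b) = aconst (coef \<beta> b) * a"
  by transfer (simp add: pure_coef_single)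


section \<open>\<open>A\<^sup>e\<close> as a quotient of \<open>A[y\<^sub>1,\<dots>,y\<^sub>n]\<close>\<close>

type_synonym ('n, 'k) polyA = "('n \<Rightarrow>\<^sub>0 nat) \<Rightarrow>\<^sub>0 ('n, 'k) alg"

abbreviation yvar :: "'n::finite \<Rightarrow> ('n, 'k::field) polyA" where
  "yvar i \<equiv> single (single i 1) 1"

text \<open>The ring homomorphism from \<open>A[y]\<close> that sends \<open>a\<close> to
  \<open>a \<otimes> 1\<close> and \<open>y_i\<close> to \<open>1 \<otimes> x_i\<close>.\<close>

definition penv :: "('n::finite, 'k::field) polyA \<Rightarrow> ('n, 'k) env" where
  "penv u = (\<Sum>\<beta>\<in>keys u. lookup u \<beta> \<otimes> amonom \<beta>)"

lemma penv_add: "penv (u + v) = penv u + penv v"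
  unfolding penv_def
  by (rule setsum_keys_plus_distrib) (simp_all add: tensor_0_left tensor_add_left)

lemma penv_0: "penv 0 = 0"
  by (simp add: penv_def)

lemma penv_uminus: "penv (- u) = - penv u"
  using penv_add[of u "- u"] by (simp add: penv_0 add_eq_0_iff)

lemma penv_diff: "penv (u - v) = penv u - penv v"
  using penv_add[of u "- v"] by (simp add: penv_uminus)

lemma penv_single: "penv (single \<beta> a) = a \<otimes> amonom \<beta>"
  by (cases "a = 0") (simp_all add: penv_def tensor_0_left)

lemma penv_1: "penv 1 = 1"
  using penv_single[of 0 1] by (simp add: amonom_0 tensor_1)

lemma penv_mult: "penv (u * v) = penv u * penv v"
proof (induction u rule: poly_mapping_induct)
  case (single s c)
  show ?case
    by (induction v rule: poly_mapping_induct)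
      (simp_all add: mult_single penv_single tensor_mult amonom_add penv_0 penv_add distrib_left)
qed (simp_all add: penv_0 penv_add distrib_right)

lemma penv_prod: "penv (\<Prod>i\<in>S. g i) = (\<Prod>i\<in>S. penv (g i))"
  by (induction S rule: infinite_finite_induct) (simp_all add: penv_1 penv_mult)

lemma penv_surj: "\<exists>u. penv u = w"
proof (induction w rule: env_induct)
  case zero
  show ?case using penv_0 by blast
next
  case (tensor a b)
  show ?case
  proof (induction b rule: alg_induct)
    case zero
    then show ?case using penv_0 by (metis tensor_0_right)
  next
    case (monom c \<beta>)
    have "penv (single \<beta> (aconst c * a)) = a \<otimes> (aconst c * amonom \<beta>)"
      by (simp add: penv_single tensor_scale)
    then show ?case by blast
  next
    case (add b b')
    then show ?case by (metis tensor_add_right penv_add)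
  qed
next
  case (add v w)
  then show ?case by (metis penv_add)
qed

lemma env_coef_penv:
  assumes "\<exists>i. lookup \<beta> i = 0"
  shows "env_coef \<beta> (penv u) = lookup u \<beta>"
proof (induction u rule: poly_mapping_induct)
  case (single \<gamma> a)
  then show ?case
    by (simp add: penv_single env_coef_tensor coef_amonom[OF assms] aconst_1 aconst_0 lookup_single when_def)
qed (simp_all add: penv_0 penv_add env_coef_0 env_coef_add lookup_add)

text \<open>Coefficients at exponents missing a variable can be read off from \<open>penv u\<close>,
  so an element of the kernel contains only multiples of \<open>y_1 ... y_n\<close>.\<close>

lemma penv_ker:
  assumes "penv u = 0"
  shows "single (expo UNIV) 1 dvd u"
proof (rule single_dvd)
  fix \<beta> :: "'a \<Rightarrow>\<^sub>0 nat" and i assume "\<beta> \<in> keys u"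
  then have nz: "lookup u \<beta> \<noteq> 0" by (simp add: in_keys_iff)
  have "lookup \<beta> i \<noteq> 0"
  proof
    assume "lookup \<beta> i = 0"
    then have "\<exists>i. lookup \<beta> i = 0" ..
    from env_coef_penv[OF this, of u] nz show False
      by (simp add: assms env_coef_0)
  qed
  then show "lookup (expo UNIV) i \<le> lookup \<beta> i"
    by (simp add: lookup_expo)
qed

text \<open>\<open>(y\<^sub>j\<^sup>b - x\<^sub>j\<^sup>b) / (y\<^sub>j - x\<^sub>j)\<close> times the other factors of \<open>y\<^sup>\<beta>\<close>, where \<open>b = \<beta>\<^sub>j\<close>.\<close>

definition ymon_quot :: "'n::finite \<Rightarrow> ('n \<Rightarrow>\<^sub>0 nat) \<Rightarrow> ('n, 'k::field) polyA" where
  "ymon_quot j \<beta> = single (\<beta> - single j (lookup \<beta> j)) 1 *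
    (\<Sum>k<lookup \<beta> j. single 0 (avar j) ^ (lookup \<beta> j - Suc k) * yvar j ^ k)"

text \<open>The difference quotient of \<open>u\<close> and its value at \<open>y_j = x_j\<close> by
  \<open>y_j - x_j\<close>; it is linear over \<open>A\<close> and defined for every
  \<open>u\<close>.\<close>

definition yquot :: "'n::finite \<Rightarrow> ('n, 'k::field) polyA \<Rightarrow> ('n, 'k) polyA" where
  "yquot j u = (\<Sum>\<beta>\<in>keys u. ymon_quot j \<beta> * single 0 (lookup u \<beta>))"

lemma yquot_add: "yquot j (u + v) = yquot j u + yquot j v"
  unfolding yquot_def
  by (rule setsum_keys_plus_distrib) (simp_all add: single_add distrib_left)

lemma yquot_0: "yquot j 0 = 0"
  by (simp add: yquot_def)

lemma yquot_uminus: "yquot j (- u) = - yquot j u"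
  using yquot_add[of j u "- u"] by (simp add: yquot_0 add_eq_0_iff)

lemma yquot_diff: "yquot j (u - v) = yquot j u - yquot j v"
  using yquot_add[of j u "- v"] by (simp add: yquot_uminus)

lemma yquot_single: "yquot j (single \<beta> a) = ymon_quot j \<beta> * single 0 a"
  by (cases "a = 0") (simp_all add: yquot_def)

lemma yvar_power: "yvar j ^ k = single (single j k) 1"
proof (induction k)
  case (Suc k)
  have "single j (Suc k) = single j 1 + single j k"
    by (simp flip: single_add)
  with Suc show ?case by (simp add: mult_single)
qed simp

text \<open>The geometric sums \<open>s_b\<close> in the quotient satisfy
  \<open>s_(b+1) = y_j^b + x_j s_b\<close>; the remaining factors of the monomial do not
  change.\<close>

lemma ymon_quot_same:
  fixes j :: "'n::finite"
  shows "ymon_quot j (\<beta> + single j 1) =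
    (single \<beta> 1 + ymon_quot j \<beta> * single 0 (avar j) :: ('n, 'k::field) polyA)"
proof -
  let ?b = "lookup \<beta> j" and ?X = "single 0 (avar j) :: ('n, 'k) polyA"
  have split: "\<beta> - single j ?b + single j ?b = \<beta>"
    by (rule poly_mapping_eqI) (simp add: lookup_add lookup_minus lookup_single when_def)
  have rest: "\<beta> + single j 1 - single j (Suc ?b) = \<beta> - single j ?b"
    by (rule poly_mapping_eqI) (simp add: lookup_add lookup_minus lookup_single when_def)
  have "(\<Sum>k<Suc ?b. ?X ^ (Suc ?b - Suc k) * yvar j ^ k)
      = (\<Sum>k<?b. ?X ^ (?b - Suc k) * yvar j ^ k) * ?X + yvar j ^ ?b"
  proof -
    have "?X ^ (Suc ?b - Suc k) * yvar j ^ k = ?X ^ (?b - Suc k) * yvar j ^ k * ?X" if "k < ?b" for k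
    proof -
      have "Suc ?b - Suc k = Suc (?b - Suc k)" using that by simp
      then show ?thesis by (simp only: power_Suc ac_simps)
    qed
    then have "(\<Sum>k<?b. ?X ^ (Suc ?b - Suc k) * yvar j ^ k)
      = (\<Sum>k<?b. ?X ^ (?b - Suc k) * yvar j ^ k) * ?X"
      unfolding sum_distrib_right by (intro sum.cong) simp_all
    then show ?thesis
      by simp
  qed
  then have "ymon_quot j (\<beta> + single j 1)
    = single (\<beta> - single j ?b) 1 * ((\<Sum>k<?b. ?X ^ (?b - Suc k) * yvar j ^ k) * ?X + yvar j ^ ?b)"
    by (simp add: ymon_quot_def lookup_add rest[unfolded One_nat_def] del: sum.lessThan_Suc)
  also have "\<dots> = ymon_quot j \<beta> * ?X + single (\<beta> - single j ?b) 1 * yvar j ^ ?b"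
    unfolding ymon_quot_def by (simp only: distrib_left mult.assoc)
  also have "single (\<beta> - single j ?b) 1 * yvar j ^ ?b = single \<beta> 1"
    by (simp add: yvar_power[unfolded One_nat_def] mult_single split)
  finally show ?thesis by (simp add: add.commute)
qed

lemma ymon_quot_other:
  assumes "i \<noteq> j"
  shows "ymon_quot j (\<beta> + single i 1) = yvar i * ymon_quot j \<beta>"
proof -
  have l: "lookup (\<beta> + single i 1) j = lookup \<beta> j"
    using assms by (simp add: lookup_add lookup_single)
  have "\<beta> + single i 1 - single j (lookup \<beta> j) = single i 1 + (\<beta> - single j (lookup \<beta> j))"
    using assms
    by (intro poly_mapping_eqI) (auto simp: lookup_add lookup_minus lookup_single when_def)
  then show ?thesis
    unfolding ymon_quot_def l by (simp add: mult_single flip: mult.assoc)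
qed

section \<open>The elements \<open>y_i - x_i\<close> and the hypersurface equation\<close>

definition theta :: "'n::finite \<Rightarrow> ('n, 'k::field) polyA" where
  "theta i = yvar i - single 0 (avar i)"

lemma theta_mult_single:
  "theta i * single \<beta> a = single (\<beta> + single i 1) a - single \<beta> (avar i * a)"
  by (simp add: theta_def left_diff_distrib mult_single add.commute)

text \<open>By additivity only monomials matter, and for these the recursion
  \<open>ymon_quot_same\<close> leaves exactly the original monomial.\<close>

lemma yquot_same: "yquot j (theta j * u) = u"
proof (induction u rule: poly_mapping_induct)
  case (single \<beta> a)
  have "yquot j (theta j * single \<beta> a)
    = (ymon_quot j (\<beta> + single j 1) - ymon_quot j \<beta> * single 0 (avar j)) * single 0 a"
    unfolding theta_mult_single yquot_diff yquot_single
    by (simp add: left_diff_distrib mult_single mult.assoc)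
  also have "\<dots> = single \<beta> a"
    by (simp add: ymon_quot_same[unfolded One_nat_def] mult_single)
  finally show ?case .
qed (simp_all add: yquot_0 yquot_add distrib_left)

lemma yquot_other:
  assumes "i \<noteq> j"
  shows "yquot j (theta i * u) = theta i * yquot j u"
proof (induction u rule: poly_mapping_induct)
  case (single \<beta> a)
  have "yquot j (theta i * single \<beta> a)
    = ymon_quot j (\<beta> + single i 1) * single 0 a - ymon_quot j \<beta> * (single 0 (avar i) * single 0 a)"
    unfolding theta_mult_single yquot_diff yquot_single by (simp add: mult_single)
  also have "\<dots> = theta i * yquot j (single \<beta> a)"
    unfolding ymon_quot_other[OF assms] yquot_single theta_def by (simp add: algebra_simps)
  finally show ?case .
qed (simp_all add: yquot_0 yquot_add distrib_left)

definition cvar :: "'n::{finite,linorder} \<Rightarrow> ('n, 'k::field) polyA" where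
  "cvar j = (\<Prod>i\<in>{..<j}. single 0 (avar i)) * (\<Prod>i\<in>{j<..}. yvar i)"

text \<open>Telescoping over all indices leaves \<open>y_1 ... y_n - x_1 ... x_n\<close>, and the
  second product is zero in the coefficient ring \<open>A\<close>.\<close>

lemma sum_theta_cvar: "(\<Sum>j\<in>UNIV. theta j * cvar j) = single (expo UNIV) 1"
proof -
  have "(\<Sum>j\<in>UNIV. cvar j * theta j) =
     (\<Prod>l\<in>-UNIV. single 0 (avar l)) * (\<Prod>l\<in>UNIV. yvar l) - (\<Prod>l\<in>UNIV. single 0 (avar l))"
    unfolding cvar_def theta_def by (rule telescope) auto
  also have "(\<Prod>l\<in>UNIV. single 0 (avar l :: ('a, 'b) alg)) = single (0 :: 'a \<Rightarrow>\<^sub>0 nat) 0"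
    by (simp only: prod_single prod_avar sum.neutral_const)
  also have "(\<Prod>l\<in>UNIV. yvar l) = single (expo (UNIV :: 'a set)) (1 :: ('a, 'b) alg)"
    by (simp only: prod_single expo_def prod.neutral_const)
  finally show ?thesis by (simp add: mult.commute)
qed

definition Xdiff :: "'n::finite \<Rightarrow> ('n, 'k::field) env" where
  "Xdiff i = 1 \<otimes> avar i - avar i \<otimes> 1"

definition cten :: "'n::{finite,linorder} \<Rightarrow> ('n, 'k::field) env" where
  "cten j = (\<Prod>i\<in>{..<j}. avar i) \<otimes> (\<Prod>i\<in>{j<..}. avar i)"

lemma penv_theta: "penv \<circ> theta = Xdiff"
  by (rule ext) (simp add: theta_def Xdiff_def penv_diff penv_single amonom_0 avar_eq)

lemma penv_cvar: "penv \<circ> cvar = cten"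
  by (rule ext) (simp add: cvar_def cten_def penv_mult penv_prod penv_single amonom_0
      avar_eq[unfolded One_nat_def, symmetric] tensor_prod tensor_mult)

lemma koszul_quotient_env:
  "koszul_quotient (theta :: 'n::{finite,linorder} \<Rightarrow> ('n, 'k::field) polyA) cvar yquot
    (single (expo UNIV) 1) penv"
proof unfold_locales
  fix x :: "('n, 'k) polyA"
  assume "single (expo UNIV) 1 * x = 0"
  then have "lookup (single (expo UNIV) 1 * x) (expo UNIV + \<beta>) = 0" for \<beta> by simp
  then show "x = 0"
    by (intro poly_mapping_eqI) (simp add: lookup_single_times_add)
qed (simp_all add: yquot_add yquot_same yquot_other sum_theta_cvar penv_0 penv_1 penv_add penv_mult
    penv_surj penv_ker)

lemma exact_env_Suc:
  fixes z :: "'n::{finite,linorder} set \<times> nat \<Rightarrow> ('n, 'k::field) env"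
  assumes "supp (Suc m) z" "\<And>x. cliff Xdiff cten z x = 0"
  shows "\<exists>u. supp (m + 2) u \<and> cliff Xdiff cten u = z"
  using koszul_quotient.exact_Suc[OF koszul_quotient_env assms(1)] assms(2)
  by (simp only: penv_theta penv_cvar)

section \<open>The augmentation ideal and exactness at \<open>F 0\<close>\<close>

definition in_aug_ideal :: "('n::finite, 'k::field) env \<Rightarrow> bool" where
  "in_aug_ideal w \<longleftrightarrow> (\<exists>g. w = (\<Sum>i\<in>UNIV. Xdiff i * g i))"

lemma in_aug_ideal_add: "in_aug_ideal v \<Longrightarrow> in_aug_ideal w \<Longrightarrow> in_aug_ideal (v + w)"
  unfolding in_aug_ideal_def
proof (elim exE)
  fix g g' assume "v = (\<Sum>i\<in>UNIV. Xdiff i * g i)" "w = (\<Sum>i\<in>UNIV. Xdiff i * g' i)"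
  then show "\<exists>g. v + w = (\<Sum>i\<in>UNIV. Xdiff i * g i)"
    by (intro exI[of _ "\<lambda>i. g i + g' i"]) (simp add: distrib_left sum.distrib)
qed

lemma in_aug_ideal_mult: "in_aug_ideal w \<Longrightarrow> in_aug_ideal (v * w)"
  unfolding in_aug_ideal_def
proof (elim exE)
  fix g assume "w = (\<Sum>i\<in>UNIV. Xdiff i * g i)"
  then show "\<exists>g. v * w = (\<Sum>i\<in>UNIV. Xdiff i * g i)"
    by (intro exI[of _ "\<lambda>i. v * g i"]) (simp add: sum_distrib_left mult.left_commute)
qed

lemma in_aug_ideal_0: "in_aug_ideal 0"
  unfolding in_aug_ideal_def by (intro exI[of _ "\<lambda>i. 0"]) simp

lemma in_aug_ideal_Xdiff: "in_aug_ideal (Xdiff i)"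
  unfolding in_aug_ideal_def
  by (intro exI[of _ "\<lambda>j. if j = i then 1 else 0"]) (simp add: if_distrib cong: if_cong)

text \<open>The elements whose two embeddings into \<open>A^e\<close> agree modulo the ideal are
  closed under products, which reduces monomials to variables.\<close>

lemma swap_mult_in_aug_ideal:
  assumes "in_aug_ideal (1 \<otimes> b - b \<otimes> 1)" "in_aug_ideal (1 \<otimes> b' - b' \<otimes> 1)"
  shows "in_aug_ideal (1 \<otimes> (b * b') - (b * b') \<otimes> 1)"
proof -
  have "1 \<otimes> (b * b') - (b * b') \<otimes> 1
      = (1 \<otimes> b) * (1 \<otimes> b' - b' \<otimes> 1) + (b' \<otimes> 1) * (1 \<otimes> b - b \<otimes> 1)"
    by (simp add: right_diff_distrib tensor_mult mult.commute)
  then show ?thesis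
    using assms by (simp only: in_aug_ideal_add in_aug_ideal_mult)
qed

lemma swap_in_aug_ideal:
  fixes b :: "('n::finite, 'k::field) alg"
  shows "in_aug_ideal (1 \<otimes> b - b \<otimes> 1)"
proof (induction b rule: alg_induct)
  case zero
  show ?case by (simp add: tensor_0_left tensor_0_right in_aug_ideal_0)
next
  case (monom c \<beta>)
  have "in_aug_ideal (1 \<otimes> aconst c - (aconst c :: ('n, 'k) alg) \<otimes> 1)"
    by (simp add: tensor_scale[of c 1 1, simplified] in_aug_ideal_0)
  moreover have "in_aug_ideal (1 \<otimes> amonom \<beta> - (amonom \<beta> :: ('n, 'k) alg) \<otimes> 1)"
  proof -
    have pow: "in_aug_ideal (1 \<otimes> amonom (single i k) - (amonom (single i k) :: ('n, 'k) alg) \<otimes> 1)" for i k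
    proof (induction k)
      case 0
      show ?case by (simp add: amonom_0 in_aug_ideal_0)
    next
      case (Suc k)
      have "single i (Suc k) = single i 1 + single i k" by (simp flip: single_add)
      then have "(amonom (single i (Suc k)) :: ('n, 'k) alg) = avar i * amonom (single i k)"
        by (simp add: amonom_add avar_eq)
      then show ?case
        using swap_mult_in_aug_ideal[OF _ Suc] in_aug_ideal_Xdiff[of i] by (simp add: Xdiff_def)
    qed
    have "in_aug_ideal (1 \<otimes> amonom (\<Sum>i\<in>S. single i (lookup \<beta> i))
        - (amonom :: _ \<Rightarrow> ('n, 'k) alg) (\<Sum>i\<in>S. single i (lookup \<beta> i)) \<otimes> 1)"
      for S
      by (induction S rule: infinite_finite_induct)
        (simp_all add: amonom_0 in_aug_ideal_0 amonom_add swap_mult_in_aug_ideal pow)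
    then show ?thesis
      by (metis poly_mapping_decomp)
  qed
  ultimately show ?case by (rule swap_mult_in_aug_ideal)
next
  case (add a b)
  have "1 \<otimes> (a + b) - (a + b) \<otimes> 1 = (1 \<otimes> a - a \<otimes> 1) + (1 \<otimes> b - b \<otimes> 1)"
    by (simp add: tensor_add_left tensor_add_right)
  then show ?case using add by (simp only: in_aug_ideal_add)
qed

text \<open>Modulo the ideal the right tensor factor can be moved to the left, so every
  \<open>w\<close> is congruent to \<open>eps w \<otimes> 1\<close>.\<close>

lemma eps_eq_0_in_aug_ideal: "eps w = 0 \<Longrightarrow> in_aug_ideal w"
proof -
  assume "eps w = 0"
  moreover have "in_aug_ideal (w - eps w \<otimes> 1)"
  proof (induction w rule: env_induct)
    case zero
    show ?case by (simp add: eps_0 tensor_0_left in_aug_ideal_0)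
  next
    case (tensor a b)
    have "a \<otimes> b - eps (a \<otimes> b) \<otimes> 1 = (a \<otimes> 1) * (1 \<otimes> b - b \<otimes> 1)"
      by (simp add: eps_tensor right_diff_distrib tensor_mult)
    then show ?case by (simp only: in_aug_ideal_mult swap_in_aug_ideal)
  next
    case (add v w)
    have "v + w - eps (v + w) \<otimes> 1 = (v - eps v \<otimes> 1) + (w - eps w \<otimes> 1)"
      by (simp add: eps_add tensor_add_left)
    then show ?case using add by (simp only: in_aug_ideal_add)
  qed
  ultimately show ?thesis by (simp add: tensor_0_left)
qed

lemma exact_env_0:
  fixes z :: "'n::{finite,linorder} set \<times> nat \<Rightarrow> ('n, 'k::field) env"
  assumes "supp 0 z" "eps (z ({}, 0)) = 0"
  shows "\<exists>u. supp 1 u \<and> cliff Xdiff cten u = z"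
proof -
  obtain g where g: "z ({}, 0) = (\<Sum>i\<in>UNIV. Xdiff i * g i)"
    using eps_eq_0_in_aug_ideal[OF assms(2)] by (auto simp: in_aug_ideal_def)
  \<comment> \<open>Degree 1 means \<open>q = 0\<close> and a singleton \<open>I\<close>, from which
    \<open>the_elem\<close> recovers the index.\<close>
  define u where "u = (\<lambda>(I, q). if card I + 2 * q = 1 then g (the_elem I) else 0)"
  have u: "supp 1 u" by (simp add: supp_def u_def)
  have "cliff Xdiff cten u x = z x" for x
  proof (cases "x = ({}, 0)")
    case True
    then show ?thesis by (simp add: cliff_def ann_def cre_def u_def g sg_def)
  next
    case False
    obtain I q where x: "x = (I, q)" by (cases x)
    have ne: "card I + 2 * q \<noteq> 0" using False x by auto
    have "supp 0 (cliff Xdiff cten u)" using u by (intro supp_cliff) simp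
    then have "cliff Xdiff cten u x = 0" unfolding x using ne by (rule suppD)
    moreover have "z x = 0" unfolding x using assms(1) ne by (rule suppD)
    ultimately show ?thesis by simp
  qed
  then have "cliff Xdiff cten u = z" by (rule ext)
  with u show ?thesis by blast
qed

section \<open>The resolution and the Yoneda product\<close>

lemma lookup_smul: "lookup (smul w v) x = w * lookup v x"
  unfolding smul_def by transfer (simp add: when_def)



lemma smul_add_left: "smul (a + b) v = smul a v + smul b v"
  by (rule poly_mapping_eqI) (simp add: lookup_smul lookup_add distrib_right)

lemma smul_0: "smul 0 v = 0"
  by (rule poly_mapping_eqI) (simp add: lookup_smul)


lemma lookup_gen: "lookup (gen I q) x = (if x = (I, q) then 1 else 0)"
  by (auto simp: gen_def lookup_single when_def)

lemma wsgn_singleton: "of_int (wsgn {j} I) = (sg j I :: 'r::comm_ring_1)"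
proof -
  have "{(a, b). a \<in> {j} \<and> b \<in> I \<and> b < a} = Pair j ` {b\<in>I. b < j}" by auto
  then have "card {(a, b). a \<in> {j} \<and> b \<in> I \<and> b < a} = card {b\<in>I. b < j}"
    by (simp add: card_image inj_on_def)
  then show ?thesis by (simp add: wsgn_def sg_def)
qed

text \<open>A generator is an indicator function. Applying \<open>ann i\<close> gives the term for
  \<open>i\<close> of the first sum and vanishes for \<open>i \<notin> I\<close>; applying
  \<open>cre j\<close> gives the wedge term for \<open>j\<close>.\<close>

lemma lookup_d_gen:
  fixes I :: "'n::{finite,linorder} set"
  shows "lookup (d_gen I q :: ('n, 'k::field) res) x = cliff Xdiff cten (lookup (gen I q)) x"
proof -
  let ?g = "gen I q :: ('n, 'k) res"
  obtain K r where x: "x = (K, r)" by (cases x)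
  have ann: "ann i (lookup ?g) x = (if i \<in> I then sg i I * lookup (gen (I - {i}) q :: ('n, 'k) res) x else 0)"
    for i
    by (auto simp: x ann_def lookup_gen sg_insert sg_remove)
  have cre: "cre j (lookup ?g) x
      = (if q = 0 then 0 else lookup (wedge_gen {j} I (q - 1)) x)" for j
  proof (cases q)
    case 0
    then show ?thesis by (simp add: x cre_def lookup_gen)
  next
    case (Suc q')
    show ?thesis
    proof (cases "j \<in> I")
      case True
      then have "K - {j} \<noteq> I" by blast
      with True show ?thesis
        by (simp add: x cre_def lookup_gen wedge_gen_def)
    next
      case False
      then have "j \<in> K \<and> K - {j} = I \<longleftrightarrow> K = insert j I" by auto
      then show ?thesis
        using False Suc by (auto simp: x cre_def lookup_gen wedge_gen_def lookup_smul wsgn_singleton sg_insert)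
    qed
  qed
  have 1: "lookup (\<Sum>i\<in>I. smul ((-1) ^ card {i'\<in>I. i' < i} * (1 \<otimes> avar i - avar i \<otimes> 1)) (gen (I - {i}) q)) x
    = (\<Sum>i\<in>UNIV. Xdiff i * ann i (lookup ?g) x)"
  proof -
    have "(\<Sum>i\<in>UNIV. Xdiff i * ann i (lookup ?g) x)
      = (\<Sum>i\<in>I. Xdiff i * ann i (lookup ?g) x)"
      by (rule sum.mono_neutral_right) (auto simp: ann)
    also have "\<dots> = (\<Sum>i\<in>I. sg i I * Xdiff i * lookup (gen (I - {i}) q) x)"
      by (intro sum.cong) (simp_all add: ann ac_simps)
    finally show ?thesis
      by (simp add: lookup_sum lookup_smul sg_def Xdiff_def)
  qed
  have 2: "lookup (if q = 0 then 0
     else \<Sum>j\<in>UNIV. smul ((\<Prod>i\<in>{..<j}. avar i) \<otimes> (\<Prod>i\<in>{j<..}. avar i)) (wedge_gen {j} I (q - 1))) x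
    = (\<Sum>j\<in>UNIV. cten j * cre j (lookup ?g) x)"
    by (simp add: cre lookup_sum lookup_smul cten_def)
  show ?thesis
    unfolding d_gen_def lookup_add 1 2 cliff_def by (simp add: sum.distrib)
qed

lemma lookup_dF: "lookup (dF v) = cliff Xdiff cten (lookup v)"
proof
  fix x
  have "lookup v = (\<lambda>y. \<Sum>s\<in>keys v. lookup v s * lookup (gen (fst s) (snd s)) y)"
    by (auto simp: lookup_gen in_keys_iff if_distrib cong: if_cong)
  then have "cliff Xdiff cten (lookup v) x
    = cliff Xdiff cten (\<lambda>y. \<Sum>s\<in>keys v. lookup v s * lookup (gen (fst s) (snd s)) y) x"
    by simp
  also have "\<dots> = (\<Sum>s\<in>keys v. lookup v s * lookup (d_gen (fst s) (snd s)) x)"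
    by (simp add: cliff_sum cliff_mult lookup_d_gen)
  also have "\<dots> = lookup (dF v) x"
    by (simp add: dF_def lookup_sum lookup_smul case_prod_beta)
  finally show "lookup (dF v) x = cliff Xdiff cten (lookup v) x" ..
qed

lemma F_iff: "v \<in> F m \<longleftrightarrow> supp m (lookup v)"
  by (auto simp: F_def supp_def in_keys_iff)

text \<open>Each degree has only finitely many basis elements, so homogeneous coefficient functions
  have finite support.\<close>

lemma ex_lookup:
  assumes "supp m u"
  shows "\<exists>v\<in>F m. lookup v = u"
proof -
  have "{x. u x \<noteq> 0} \<subseteq> UNIV \<times> {..m}"
  proof
    fix x assume "x \<in> {x. u x \<noteq> 0}"
    then have "card (fst x) + 2 * snd x = m"
      using suppD[OF assms, of "fst x" "snd x"] by auto
    then show "x \<in> UNIV \<times> {..m}" by (cases x) simp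
  qed
  then have "finite {x. u x \<noteq> 0}"
    by (rule finite_subset) simp
  then have "lookup (Abs_poly_mapping u) = u" by simp
  then show ?thesis
    using assms by (metis F_iff)
qed

lemma Xdiff_cten_sum: "(\<Sum>i\<in>UNIV. Xdiff i * cten i) = 0"
proof -
  have penv_sum: "penv (sum g S) = (\<Sum>i\<in>S. penv (g i))" for g :: "'a \<Rightarrow> ('a, 'b) polyA" and S
    by (induction S rule: infinite_finite_induct) (simp_all add: penv_0 penv_add)
  have "(\<Sum>i\<in>UNIV. (penv \<circ> theta) i * (penv \<circ> cvar) i)
      = penv (\<Sum>i\<in>UNIV. theta i * cvar i :: ('a, 'b) polyA)"
    by (simp add: penv_sum penv_mult)
  also have "\<dots> = 0"
    by (simp only: sum_theta_cvar penv_single amonom_expo prod_avar tensor_0_right)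
  finally show ?thesis by (simp only: penv_theta penv_cvar)
qed

lemma dF_add: "dF (v + w) = dF v + dF w"
proof (rule poly_mapping_eqI)
  have "lookup (v + w) = (\<lambda>x. lookup v x + lookup w x)" by (rule ext) (rule lookup_add)
  then show "lookup (dF (v + w)) x = lookup (dF v + dF w) x" for x
    by (simp add: lookup_dF lookup_add cliff_add)
qed

lemma dF_smul: "dF (smul c v) = smul c (dF v)"
proof (rule poly_mapping_eqI)
  have "lookup (smul c v) = (\<lambda>x. c * lookup v x)" by (rule ext) (rule lookup_smul)
  then show "lookup (dF (smul c v)) x = lookup (smul c (dF v)) x" for x
    by (simp add: lookup_dF lookup_smul cliff_mult)
qed

lemma dF_0: "dF 0 = 0"
  by (simp add: dF_def)

lemma dF_uminus: "dF (- v) = - dF v"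
  using dF_add[of v "- v"] by (simp add: dF_0 add_eq_0_iff)

lemma dF_diff: "dF (v - w) = dF v - dF w"
  using dF_add[of v "- w"] by (simp add: dF_uminus)

lemma dF_dF: "dF (dF v) = 0"
  by (rule poly_mapping_eqI) (simp add: lookup_dF cliff_sq Xdiff_cten_sum)

lemma dF_F: "v \<in> F (Suc m) \<Longrightarrow> dF v \<in> F m"
  by (simp add: F_iff lookup_dF supp_cliff)

lemma dF_F_0: "v \<in> F 0 \<Longrightarrow> dF v = 0"
  by (rule poly_mapping_eqI) (simp add: F_iff lookup_dF supp_0_cliff)

lemma F_0: "0 \<in> F m"
  by (simp add: F_def)

lemma F_add: "v \<in> F m \<Longrightarrow> w \<in> F m \<Longrightarrow> v + w \<in> F m"
  by (simp add: F_iff supp_def lookup_add)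

lemma F_diff: "v \<in> F m \<Longrightarrow> w \<in> F m \<Longrightarrow> v - w \<in> F m"
  by (simp add: F_iff supp_def lookup_minus)

lemma F_smul: "v \<in> F m \<Longrightarrow> smul c v \<in> F m"
  by (simp add: F_iff supp_def lookup_smul)

lemma F_sum: "(\<And>x. x \<in> S \<Longrightarrow> g x \<in> F m) \<Longrightarrow> sum g S \<in> F m"
  by (induction S rule: infinite_finite_induct) (simp_all add: F_0 F_add)

lemma F_gen: "card I + 2 * q = m \<Longrightarrow> gen I q \<in> F m"
  by (auto simp: F_iff supp_def lookup_gen)

text \<open>For \<open>m = 0\<close> this relies on \<open>0 - 1 = 0\<close> and \<open>dF\<close>
  vanishing on \<open>F 0\<close>. The same convention covers degree 0 in the statements about
  homotopies and coboundaries.\<close>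

lemma dF_F_pred: "v \<in> F m \<Longrightarrow> dF v \<in> F (m - 1)"
  by (cases m) (simp_all add: dF_F dF_F_0 F_0)

lemma exact_res:
  assumes "v \<in> F m" "dF v = 0" "m = 0 \<Longrightarrow> aug v = 0"
  shows "\<exists>w\<in>F (Suc m). dF w = v"
proof -
  have "\<exists>u. supp (Suc m) u \<and> cliff Xdiff cten u = lookup v"
  proof (cases m)
    case 0
    then show ?thesis
      using exact_env_0[of "lookup v"] assms by (simp add: F_iff aug_def)
  next
    case (Suc m')
    have "cliff Xdiff cten (lookup v) x = 0" for x
      using assms(2) by (simp flip: lookup_dF)
    then show ?thesis
      using exact_env_Suc[of m' "lookup v"] assms(1) Suc by (simp add: F_iff)
  qed
  then obtain u where u: "supp (Suc m) u" "cliff Xdiff cten u = lookup v" by blast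
  obtain w where "w \<in> F (Suc m)" "lookup w = u"
    using ex_lookup[OF u(1)] by blast
  then have "dF w = v"
    using u(2) by (intro poly_mapping_eqI) (simp add: lookup_dF)
  with \<open>w \<in> F (Suc m)\<close> show ?thesis by blast
qed

section \<open>Linear maps on the free modules \<open>F m\<close>\<close>

definition basis :: "nat \<Rightarrow> ('n::finite set \<times> nat) set" where
  "basis m = {(I, q). card I + 2 * q = m}"

lemma finite_basis: "finite (basis m)"
proof -
  have "basis m \<subseteq> UNIV \<times> {..m}" by (auto simp: basis_def)
  then show ?thesis by (rule finite_subset) simp
qed

text \<open>Linearity without the extensionality built into \<open>HomFF\<close>, so that
  differences and composites need no restriction.\<close>

definition linF :: "nat \<Rightarrow> nat \<Rightarrow> (('n::finite, 'k::field) res \<Rightarrow> ('n, 'k) res) \<Rightarrow> bool" where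
  "linF m l s \<longleftrightarrow> (\<forall>v\<in>F m. s v \<in> F l) \<and> (\<forall>v\<in>F m. \<forall>w\<in>F m. s (v + w) = s v + s w) \<and>
     (\<forall>c. \<forall>v\<in>F m. s (smul c v) = smul c (s v))"

definition linA :: "nat \<Rightarrow> ('n::finite, 'k::field) cochain \<Rightarrow> bool" where
  "linA m f \<longleftrightarrow> (\<forall>v\<in>F m. \<forall>w\<in>F m. f (v + w) = f v + f w) \<and>
     (\<forall>c. \<forall>v\<in>F m. f (smul c v) = eps c * f v)"

lemma HomFA_iff: "f \<in> HomFA m \<longleftrightarrow> f \<in> extensional (F m) \<and> linA m f"
  by (auto simp: HomFA_def linA_def act_def)

lemma HomFF_linF: "f \<in> HomFF m l \<Longrightarrow> linF m l f"
  unfolding HomFF_def linF_def by blast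

lemma linA_restrict: "linA m (restrict f (F m)) \<longleftrightarrow> linA m f"
  by (auto simp: linA_def F_add F_smul)

lemma linF_in: "linF m l s \<Longrightarrow> v \<in> F m \<Longrightarrow> s v \<in> F l"
  and linF_add: "linF m l s \<Longrightarrow> v \<in> F m \<Longrightarrow> w \<in> F m \<Longrightarrow> s (v + w) = s v + s w"
  and linF_smul: "linF m l s \<Longrightarrow> v \<in> F m \<Longrightarrow> s (smul c v) = smul c (s v)"
  by (auto simp: linF_def)

lemma linA_add: "linA m f \<Longrightarrow> v \<in> F m \<Longrightarrow> w \<in> F m \<Longrightarrow> f (v + w) = f v + f w"
  and linA_smul: "linA m f \<Longrightarrow> v \<in> F m \<Longrightarrow> f (smul c v) = eps c * f v"
  by (auto simp: linA_def)

lemma linF_0: "linF m l s \<Longrightarrow> s 0 = 0"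
  using linF_smul[of m l s 0 0] by (simp add: F_0 smul_0)

lemma linA_0: "linA m f \<Longrightarrow> f 0 = 0"
  using linA_smul[of m f 0 0] by (simp add: F_0 smul_0 eps_0)


lemma linA_diff: "linA m f \<Longrightarrow> v \<in> F m \<Longrightarrow> w \<in> F m \<Longrightarrow> f (v - w) = f v - f w"
  using linA_add[of m f "v - w" w] by (simp add: F_diff)

lemma linF_sum:
  "linF m l s \<Longrightarrow> (\<And>x. x \<in> S \<Longrightarrow> g x \<in> F m) \<Longrightarrow> s (\<Sum>x\<in>S. g x) = (\<Sum>x\<in>S. s (g x))"
  by (induction S rule: infinite_finite_induct) (simp_all add: linF_0 linF_add F_sum)

lemma linA_sum:
  "linA m f \<Longrightarrow> (\<And>x. x \<in> S \<Longrightarrow> g x \<in> F m) \<Longrightarrow> f (\<Sum>x\<in>S. g x) = (\<Sum>x\<in>S. f (g x))"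
  by (induction S rule: infinite_finite_induct) (simp_all add: linA_0 linA_add F_sum)

abbreviation gens :: "'n set \<times> nat \<Rightarrow> ('n::finite, 'k::field) res" where
  "gens x \<equiv> gen (fst x) (snd x)"

lemma gens_F: "x \<in> basis m \<Longrightarrow> gens x \<in> F m"
  by (auto simp: basis_def intro: F_gen)

lemma expand:
  assumes "v \<in> F m"
  shows "v = (\<Sum>x\<in>basis m. smul (lookup v x) (gens x))"
proof (rule poly_mapping_eqI)
  fix y
  have "lookup v y = 0" if "y \<notin> basis m"
    using that assms by (cases y) (simp add: F_iff supp_def basis_def)
  then show "lookup v y = lookup (\<Sum>x\<in>basis m. smul (lookup v x) (gens x)) y"
    by (auto simp: lookup_sum lookup_smul lookup_gen finite_basis if_distrib cong: if_cong)
qed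

lemma linF_expand:
  assumes "linF m l s" "v \<in> F m"
  shows "s v = (\<Sum>x\<in>basis m. smul (lookup v x) (s (gens x)))"
proof -
  have "s v = s (\<Sum>x\<in>basis m. smul (lookup v x) (gens x))"
    using expand[OF assms(2)] by simp
  also have "\<dots> = (\<Sum>x\<in>basis m. smul (lookup v x) (s (gens x)))"
    by (simp add: linF_sum[OF assms(1)] linF_smul[OF assms(1)] F_smul gens_F)
  finally show ?thesis .
qed

lemma linA_expand:
  assumes "linA m f" "v \<in> F m"
  shows "f v = (\<Sum>x\<in>basis m. eps (lookup v x) * f (gens x))"
proof -
  have "f v = f (\<Sum>x\<in>basis m. smul (lookup v x) (gens x))"
    using expand[OF assms(2)] by simp
  also have "\<dots> = (\<Sum>x\<in>basis m. eps (lookup v x) * f (gens x))"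
    by (simp add: linA_sum[OF assms(1)] linA_smul[OF assms(1)] F_smul gens_F)
  finally show ?thesis .
qed

lemma linF_free:
  assumes "\<And>x. x \<in> basis m \<Longrightarrow> y x \<in> F l"
  shows "\<exists>s. linF m l s \<and> (\<forall>x\<in>basis m. s (gens x) = y x)"
proof (intro exI conjI ballI)
  let ?s = "\<lambda>v. \<Sum>x\<in>basis m. smul (lookup v x) (y x)"
  show "linF m l ?s"
    unfolding linF_def
  proof (intro conjI ballI allI)
    show "?s v \<in> F l" for v
      by (intro F_sum F_smul assms)
    show "?s (v + w) = ?s v + ?s w" for v w
      by (simp add: lookup_add smul_add_left sum.distrib)
    show "?s (smul c v) = smul c (?s v)" for c v
      by (rule poly_mapping_eqI) (simp add: lookup_sum lookup_smul sum_distrib_left mult.assoc)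
  qed
  fix x :: "'a set \<times> nat" assume "x \<in> basis m"
  then show "?s (gens x) = y x"
    by (intro poly_mapping_eqI)
      (simp add: lookup_sum lookup_smul lookup_gen finite_basis if_distrib[of "\<lambda>z. z * _"] cong: if_cong)
qed

lemma linF_sub: "linF m l s \<Longrightarrow> linF m l t \<Longrightarrow> linF m l (\<lambda>v. s v - t v)"
  unfolding linF_def
  by (auto simp: F_diff intro!: poly_mapping_eqI simp: lookup_minus lookup_add lookup_smul algebra_simps)

lemma linF_comp_dF: "linF (m - 1) l s \<Longrightarrow> linF m l (\<lambda>v. s (dF v))"
  unfolding linF_def by (simp add: dF_add dF_smul dF_F_pred[unfolded One_nat_def])

text \<open>Exactness gives preimages of the images of the basis elements, and freeness extends the
  choice linearly.\<close>

lemma lift_through_dF: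
  assumes t: "linF m l t" and cycle: "\<And>v. v \<in> F m \<Longrightarrow> dF (t v) = 0"
    and aug: "\<And>v. l = 0 \<Longrightarrow> v \<in> F m \<Longrightarrow> aug (t v) = 0"
  shows "\<exists>s. linF m (Suc l) s \<and> (\<forall>v\<in>F m. dF (s v) = t v)"
proof -
  have "\<forall>x\<in>basis m. \<exists>w\<in>F (Suc l). dF w = t (gens x)"
    by (intro ballI exact_res) (simp_all add: linF_in[OF t] cycle aug gens_F)
  then obtain y where y: "\<And>x. x \<in> basis m \<Longrightarrow> y x \<in> F (Suc l)"
      "\<And>x. x \<in> basis m \<Longrightarrow> dF (y x) = t (gens x)"
    by metis
  obtain s where s: "linF m (Suc l) s" "\<And>x. x \<in> basis m \<Longrightarrow> s (gens x) = y x"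
    using linF_free[of m y "Suc l"] y(1) by blast
  have ds: "linF m l (\<lambda>v. dF (s v))"
    unfolding linF_def
    using linF_in[OF s(1)] linF_add[OF s(1)] linF_smul[OF s(1)] by (simp add: dF_F dF_add dF_smul)
  have "dF (s v) = t v" if "v \<in> F m" for v
    unfolding linF_expand[OF ds that] linF_expand[OF t that]
    by (intro sum.cong) (simp_all add: s(2) y(2))
  with s(1) show ?thesis by blast
qed

section \<open>Homotopies between lifts\<close>

lemma aug_add: "aug (v + w) = aug v + aug w"
  by (simp add: aug_def lookup_add eps_add)

lemma aug_diff: "aug (v - w) = aug v - aug w"
  by (simp add: aug_def lookup_minus eps_diff)

lemma aug_smul: "aug (smul c v) = eps c * aug v"
  by (simp add: aug_def lookup_smul eps_mult)

text \<open>The comparison theorem for a chain map covering \<open>\<phi> \<circ> dF\<close> instead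
  of zero, because two lifts may start from different representatives of one class. In the induction
  each \<open>S\<close> becomes the next \<open>R\<close>.\<close>

lemma homotopy:
  fixes h :: "nat \<Rightarrow> ('n::{finite,linorder}, 'k::field) res \<Rightarrow> ('n, 'k) res"
  assumes h: "\<And>l. linF (i + l) l (h l)"
    and comm: "\<And>l v. v \<in> F (i + Suc l) \<Longrightarrow> dF (h (Suc l) v) = h l (dF v)"
    and \<phi>: "linA (i - 1) \<phi>" and base: "\<And>v. v \<in> F i \<Longrightarrow> aug (h 0 v) = \<phi> (dF v)"
  shows "\<exists>S R. linF (i + l) (Suc l) S \<and> linF (i + l - 1) l R \<and>
    (\<forall>v\<in>F (i + l). h l v = dF (S v) + R (dF v))"
proof (induction l)
  case 0
  \<comment> \<open>This \<open>R\<close> lifts \<open>\<phi>\<close> through the augmentation,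
    since \<open>eps (a \<otimes> 1) = a\<close>.\<close>
  obtain R where R: "linF (i - 1) 0 R"
      "\<And>x. x \<in> basis (i - 1) \<Longrightarrow> R (gens x) = smul (\<phi> (gens x) \<otimes> 1) (gen {} 0)"
    using linF_free[of "i - 1" "\<lambda>x. smul (\<phi> (gens x) \<otimes> 1) (gen {} 0)" 0]
    by (auto simp: F_smul F_gen)
  have augR: "aug (R v) = \<phi> v" if "v \<in> F (i - 1)" for v
  proof -
    have "linA (i - 1) (\<lambda>v. aug (R v))"
      unfolding linA_def using linF_add[OF R(1)] linF_smul[OF R(1)] by (simp add: aug_add aug_smul)
    then show ?thesis
      unfolding linA_expand[OF \<open>linA (i - 1) (\<lambda>v. aug (R v))\<close> that] linA_expand[OF \<phi> that]
      by (intro sum.cong) (simp_all add: R(2) aug_smul eps_tensor, simp add: aug_def lookup_gen eps_1)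
  qed
  have h0: "linF i 0 (h 0)" using h[of 0] by simp
  have t: "linF i 0 (\<lambda>v. h 0 v - R (dF v))"
    by (intro linF_sub h0 linF_comp_dF R(1))
  have "\<exists>S. linF i (Suc 0) S \<and> (\<forall>v\<in>F i. dF (S v) = h 0 v - R (dF v))"
  proof (rule lift_through_dF[OF t])
    show "dF (h 0 v - R (dF v)) = 0" if "v \<in> F i" for v
      using linF_in[OF t that] by (rule dF_F_0)
    show "aug (h 0 v - R (dF v)) = 0" if "v \<in> F i" for v
      using that by (simp add: aug_diff base augR[OF dF_F_pred])
  qed
  then obtain S where "linF i (Suc 0) S" "\<And>v. v \<in> F i \<Longrightarrow> dF (S v) = h 0 v - R (dF v)" by blast
  with R(1) show ?case by (intro exI[of _ S] exI[of _ R]) simp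
next
  case (Suc l)
  then obtain S R where S: "linF (i + l) (Suc l) S" and R: "linF (i + l - 1) l R"
    and SR: "\<And>v. v \<in> F (i + l) \<Longrightarrow> h l v = dF (S v) + R (dF v)" by blast
  have t: "linF (i + Suc l) (Suc l) (\<lambda>v. h (Suc l) v - S (dF v))"
    using S by (intro linF_sub h linF_comp_dF) simp
  have "\<exists>T. linF (i + Suc l) (Suc (Suc l)) T \<and>
      (\<forall>v\<in>F (i + Suc l). dF (T v) = h (Suc l) v - S (dF v))"
  proof (rule lift_through_dF[OF t])
    fix v :: "('n, 'k) res" assume v: "v \<in> F (i + Suc l)"
    then have "dF v \<in> F (i + l)" by (intro dF_F) simp
    then show "dF (h (Suc l) v - S (dF v)) = 0"
      by (simp add: dF_diff comm[OF v] SR dF_dF linF_0[OF R])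
  qed simp
  then obtain T where "linF (i + Suc l) (Suc (Suc l)) T"
      "\<And>v. v \<in> F (i + Suc l) \<Longrightarrow> dF (T v) = h (Suc l) v - S (dF v)" by blast
  with S show ?case by (intro exI[of _ T] exI[of _ S]) simp
qed

section \<open>Cohomology classes and independence of choices\<close>

lemma coboundaries_iff:
  "c \<in> coboundaries m \<longleftrightarrow> (\<exists>\<chi>. linA (m - 1) \<chi> \<and> c = (\<lambda>v\<in>F m. \<chi> (dF v)))"
proof (cases m)
  case 0
  \<comment> \<open>In degree 0 the formula yields only the zero cochain, because \<open>dF\<close>
    vanishes on \<open>F 0\<close>.\<close>
  have "(\<lambda>v\<in>F 0. \<chi> (dF v)) = zero_cochain 0" if "linA 0 \<chi>" for \<chi> :: "('a, 'b) cochain"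
    by (auto simp: zero_cochain_def dF_F_0 linA_0[OF that])
  moreover have "linA 0 (\<lambda>v. 0 :: ('a, 'b) alg)" by (simp add: linA_def)
  ultimately show ?thesis
    using 0 by (metis coboundaries.simps(1) diff_0_eq_0 singleton_iff)
next
  case (Suc m')
  have "c \<in> delta m' ` HomFA m'" if \<chi>: "linA m' \<chi>" "c = (\<lambda>v\<in>F (Suc m'). \<chi> (dF v))" for \<chi>
  proof (rule image_eqI)
    show "restrict \<chi> (F m') \<in> HomFA m'"
      using \<chi>(1) by (simp add: HomFA_iff linA_restrict)
    show "c = delta m' (restrict \<chi> (F m'))"
      using \<chi>(2) by (auto simp: delta_def dF_F)
  qed
  moreover have "linA m' \<chi>" if "\<chi> \<in> HomFA m'" for \<chi> :: "('a, 'b) cochain"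
    using that by (simp add: HomFA_iff)
  ultimately show ?thesis
    using Suc by (auto simp: delta_def)
qed

lemma linA_plus: "linA m f \<Longrightarrow> linA m g \<Longrightarrow> linA m (\<lambda>v. f v + g v)"
  by (simp add: linA_def algebra_simps)

lemma linA_times: "linA m f \<Longrightarrow> linA m (\<lambda>v. c * f v)"
  by (simp add: linA_def algebra_simps)

lemma linA_comp: "linA l f \<Longrightarrow> linF m l s \<Longrightarrow> linA m (\<lambda>v. f (s v))"
  by (simp add: linA_def linF_def)

lemma linA_zero: "linA m (\<lambda>v. 0)"
  by (simp add: linA_def)

definition cohomologous ::
  "nat \<Rightarrow> ('n::{finite,linorder}, 'k::field) cochain \<Rightarrow> ('n, 'k) cochain \<Rightarrow> bool" where
  "cohomologous m f g \<longleftrightarrow> (\<exists>\<chi>. linA (m - 1) \<chi> \<and> (\<forall>v\<in>F m. g v = f v + \<chi> (dF v)))"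

lemma HH_class_iff: "g \<in> HH_class m f \<longleftrightarrow> g \<in> cocycles m \<and> cohomologous m f g"
  by (auto simp: HH_class_def coboundaries_iff cohomologous_def fun_eq_iff restrict_def algebra_simps)

lemma cohomologous_refl: "cohomologous m f f"
  unfolding cohomologous_def by (intro exI[of _ "\<lambda>v. 0"]) (simp add: linA_zero)

lemma cohomologous_sym: "cohomologous m f g \<Longrightarrow> cohomologous m g f"
  unfolding cohomologous_def
proof (elim exE conjE)
  fix \<chi> assume "linA (m - 1) \<chi>" "\<forall>v\<in>F m. g v = f v + \<chi> (dF v)"
  then show "\<exists>\<chi>. linA (m - 1) \<chi> \<and> (\<forall>v\<in>F m. f v = g v + \<chi> (dF v))"
    using linA_times[of "m - 1" \<chi> "-1"] by (intro exI[of _ "\<lambda>v. - 1 * \<chi> v"]) simp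
qed

lemma cohomologous_trans: "cohomologous m f g \<Longrightarrow> cohomologous m g h \<Longrightarrow> cohomologous m f h"
  unfolding cohomologous_def
proof (elim exE conjE)
  fix \<chi> \<psi> assume "linA (m - 1) \<chi>" "\<forall>v\<in>F m. g v = f v + \<chi> (dF v)"
    "linA (m - 1) \<psi>" "\<forall>v\<in>F m. h v = g v + \<psi> (dF v)"
  then show "\<exists>\<chi>. linA (m - 1) \<chi> \<and> (\<forall>v\<in>F m. h v = f v + \<chi> (dF v))"
    by (intro exI[of _ "\<lambda>v. \<chi> v + \<psi> v"]) (simp add: linA_plus add.assoc)
qed

lemma cohomologous_times:
  "cohomologous m f g \<Longrightarrow> cohomologous m (\<lambda>v\<in>F m. c * f v) (\<lambda>v\<in>F m. c * g v)"
  unfolding cohomologous_def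
proof (elim exE conjE)
  fix \<chi> assume "linA (m - 1) \<chi>" "\<forall>v\<in>F m. g v = f v + \<chi> (dF v)"
  then show "\<exists>\<chi>. linA (m - 1) \<chi> \<and>
      (\<forall>v\<in>F m. (\<lambda>v\<in>F m. c * g v) v = (\<lambda>v\<in>F m. c * f v) v + \<chi> (dF v))"
    by (intro exI[of _ "\<lambda>v. c * \<chi> v"]) (simp add: linA_times distrib_left)
qed

lemma HH_class_eqI: "cohomologous m f g \<Longrightarrow> HH_class m f = HH_class m g"
  unfolding set_eq_iff HH_class_iff by (blast intro: cohomologous_trans cohomologous_sym)

lemma self_in_HH_class: "f \<in> cocycles m \<Longrightarrow> f \<in> HH_class m f"
  by (simp add: HH_class_iff cohomologous_refl)

text \<open>All representatives give the same scaled class, and the union is nonempty because it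
  includes \<open>f\<close> itself.\<close>

lemma HH_scale_class:
  assumes "f \<in> cocycles m"
  shows "HH_scale m c (HH_class m f) = HH_class m (\<lambda>v\<in>F m. of_int c * f v)"
proof -
  have eq: "HH_class m (\<lambda>v\<in>F m. of_int c * g v) = HH_class m (\<lambda>v\<in>F m. of_int c * f v)"
    if "g \<in> HH_class m f" for g
    using that by (intro HH_class_eqI[OF cohomologous_sym] cohomologous_times) (simp add: HH_class_iff)
  have "HH_class m f \<noteq> {}" using self_in_HH_class[OF assms] by blast
  then show ?thesis
    unfolding HH_scale_def by (rule SUP_eq_const) (rule eq)
qed

lemma cocycles_iff:
  "f \<in> cocycles m \<longleftrightarrow> f \<in> extensional (F m) \<and> linA m f \<and> (\<forall>v\<in>F (Suc m). f (dF v) = 0)"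
  by (auto simp: cocycles_def HomFA_iff delta_def zero_cochain_def fun_eq_iff restrict_def)

lemma cocycle_times:
  "f \<in> cocycles m \<Longrightarrow> (\<lambda>v\<in>F m. c * f v) \<in> cocycles m"
  by (simp add: cocycles_iff linA_restrict linA_times dF_F)

lemma lift_comp_cocycle:
  assumes "is_lift i f ft" "g \<in> cocycles j"
  shows "(\<lambda>v\<in>F (i + j). g (ft j v)) \<in> cocycles (i + j)"
proof -
  have ft: "linF (i + l) l (ft l)" for l
    using assms(1) by (simp add: is_lift_def HomFF_linF)
  have "g (ft j (dF v)) = 0" if "v \<in> F (Suc (i + j))" for v
  proof -
    have v: "v \<in> F (i + Suc j)" using that by simp
    then have "ft j (dF v) = dF (ft (Suc j) v)"
      using assms(1) by (simp add: is_lift_def)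
    then show ?thesis
      using linF_in[OF ft v] assms(2) by (simp add: cocycles_iff)
  qed
  moreover have "linA (i + j) (\<lambda>v. g (ft j v))"
    using assms(2) by (intro linA_comp[OF _ ft[of j], of g]) (simp add: cocycles_iff)
  ultimately show ?thesis
    by (simp add: cocycles_iff linA_restrict dF_F)
qed

text \<open>The difference of the lifts is \<open>dF \<circ> S + R \<circ> dF\<close>: the cocycle
  \<open>g\<close> kills the first term and turns the second into a coboundary. Replacing
  \<open>g\<close> by \<open>g'\<close> adds a coboundary precomposed with a chain map.\<close>

lemma lift_comp_cohomologous:
  assumes lift: "is_lift i f ft" "is_lift i f' ft'"
    and f: "cohomologous i f f'" and g: "g \<in> cocycles j" "cohomologous j g g'"
  shows "cohomologous (i + j) (\<lambda>v\<in>F (i + j). g (ft j v)) (\<lambda>v\<in>F (i + j). g' (ft' j v))"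
proof -
  have ft: "linF (i + l) l (ft l)" "linF (i + l) l (ft' l)" for l
    using lift by (simp_all add: is_lift_def HomFF_linF)
  obtain \<phi> where \<phi>: "linA (i - 1) \<phi>" "\<And>v. v \<in> F i \<Longrightarrow> f' v = f v + \<phi> (dF v)"
    using f by (auto simp: cohomologous_def)
  obtain \<psi> where \<psi>: "linA (j - 1) \<psi>" "\<And>v. v \<in> F j \<Longrightarrow> g' v = g v + \<psi> (dF v)"
    using g by (auto simp: cohomologous_def)
  have "\<exists>S R. linF (i + j) (Suc j) S \<and> linF (i + j - 1) j R \<and>
    (\<forall>v\<in>F (i + j). ft' j v - ft j v = dF (S v) + R (dF v))"
  proof (rule homotopy[of i "\<lambda>l v. ft' l v - ft l v", OF _ _ \<phi>(1)])
    show "linF (i + l) l (\<lambda>v. ft' l v - ft l v)" for l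
      by (intro linF_sub ft)
    show "dF (ft' (Suc l) v - ft (Suc l) v) = ft' l (dF v) - ft l (dF v)" if "v \<in> F (i + Suc l)" for l v
      using lift that by (simp add: is_lift_def dF_diff)
    show "aug (ft' 0 v - ft 0 v) = \<phi> (dF v)" if "v \<in> F i" for v
      using lift that \<phi>(2) by (simp add: is_lift_def aug_diff)
  qed
  then obtain S R where S: "linF (i + j) (Suc j) S" and R: "linF (i + j - 1) j R"
    and SR: "\<And>v. v \<in> F (i + j) \<Longrightarrow> ft' j v - ft j v = dF (S v) + R (dF v)" by blast
  have gl: "linA j g" using g(1) by (simp add: cocycles_iff)
  have 1: "g (ft' j v) = g (ft j v) + g (R (dF v))" if v: "v \<in> F (i + j)" for v
  proof -
    have "g (ft' j v) - g (ft j v) = g (ft' j v - ft j v)"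
      using linF_in[OF ft(1) v] linF_in[OF ft(2) v] by (simp add: linA_diff[OF gl])
    also have "\<dots> = g (dF (S v)) + g (R (dF v))"
      unfolding SR[OF v] using linF_in[OF S v] linF_in[OF R dF_F_pred[OF v]]
      by (intro linA_add[OF gl]) (simp_all add: dF_F)
    also have "g (dF (S v)) = 0"
      using linF_in[OF S v] g(1) by (simp add: cocycles_iff)
    finally show ?thesis by (simp add: algebra_simps)
  qed
  \<comment> \<open>For positive \<open>j\<close> the differential moves past the lift, which then
    has index \<open>j - 1\<close>; for \<open>j = 0\<close> the expression is zero.\<close>
  have "\<exists>\<chi>. linA (i + j - 1) \<chi> \<and> (\<forall>v\<in>F (i + j). \<psi> (dF (ft' j v)) = \<chi> (dF v))"
  proof (cases j)
    case 0
    then have "\<psi> (dF (ft' j v)) = 0" if "v \<in> F (i + j)" for v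
      using linF_in[OF ft(2) that] linA_0[OF \<psi>(1)] by (simp add: dF_F_0)
    then show ?thesis by (intro exI[of _ "\<lambda>v. 0"]) (simp add: linA_zero)
  next
    case (Suc j')
    then have "linA j' \<psi>" using \<psi>(1) by simp
    then have "linA (i + j') (\<lambda>v. \<psi> (ft' j' v))" by (rule linA_comp[OF _ ft(2)])
    then show ?thesis
      using lift(2) Suc by (intro exI[of _ "\<lambda>v. \<psi> (ft' j' v)"]) (simp add: is_lift_def)
  qed
  then obtain \<chi> where \<chi>: "linA (i + j - 1) \<chi>" "\<And>v. v \<in> F (i + j) \<Longrightarrow> \<psi> (dF (ft' j v)) = \<chi> (dF v)"
    by blast
  have "linA (i + j - 1) (\<lambda>v. g (R v) + \<chi> v)"
    by (intro linA_plus linA_comp[OF gl R] \<chi>(1))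
  moreover have "g' (ft' j v) = g (ft j v) + (g (R (dF v)) + \<chi> (dF v))" if v: "v \<in> F (i + j)" for v
    using \<psi>(2)[OF linF_in[OF ft(2) v]] 1[OF v] \<chi>(2)[OF v] by (simp add: add.assoc)
  ultimately show ?thesis
    unfolding cohomologous_def by (intro exI[of _ "\<lambda>v. g (R v) + \<chi> v"]) simp
qed

lemma yoneda_class:
  assumes "is_lift i f ft" "f \<in> cocycles i" "g \<in> cocycles j"
  shows "yoneda i j (HH_class i f) (HH_class j g) = HH_class (i + j) (\<lambda>v\<in>F (i + j). g (ft j v))"
proof -
  have eq: "HH_class (i + j) (\<lambda>v\<in>F (i + j). g' (ft' j v)) = HH_class (i + j) (\<lambda>v\<in>F (i + j). g (ft j v))"
    if "f' \<in> HH_class i f" "g' \<in> HH_class j g" "is_lift i f' ft'" for f' g' ft'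
  proof -
    have "cohomologous i f f'" "cohomologous j g g'"
      using that(1,2) by (simp_all add: HH_class_iff)
    then show ?thesis
      using lift_comp_cohomologous[OF assms(1) that(3) _ assms(3)] by (intro HH_class_eqI[OF cohomologous_sym])
  qed
  show ?thesis
  proof (rule equalityI)
    show "yoneda i j (HH_class i f) (HH_class j g) \<subseteq> HH_class (i + j) (\<lambda>v\<in>F (i + j). g (ft j v))"
      unfolding yoneda_def by (intro UN_least equalityD1 eq) simp_all
    show "HH_class (i + j) (\<lambda>v\<in>F (i + j). g (ft j v)) \<subseteq> yoneda i j (HH_class i f) (HH_class j g)"
      unfolding yoneda_def using assms(1) self_in_HH_class[OF assms(2)] self_in_HH_class[OF assms(3)]
      by blast
  qed
qed

lemma cup_class:
  assumes "is_lift i f ft" "f \<in> cocycles i" "g \<in> cocycles j"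
  shows "cup i j (HH_class i f) (HH_class j g)
    = HH_class (i + j) (\<lambda>v\<in>F (i + j). (-1) ^ (i * j) * g (ft j v))"
  unfolding cup_def yoneda_class[OF assms] HH_scale_class[OF lift_comp_cocycle[OF assms(1,3)]]
  by (intro arg_cong[of _ _ "HH_class (i + j)"]) auto

section \<open>Explicit lifts of cocycles\<close>

abbreviation xprod :: "'n::finite set \<Rightarrow> ('n, 'k::field) alg" where
  "xprod J \<equiv> \<Prod>i\<in>J. avar i"

definition contr :: "'n::{finite,linorder} \<Rightarrow> ('n set \<times> nat \<Rightarrow> ('n, 'k::field) env) \<Rightarrow>
    'n set \<times> nat \<Rightarrow> ('n, 'k) env" where
  "contr i = cliff (\<lambda>j. if j = i then avar i \<otimes> 1 else 0) (\<lambda>j. if i < j then - cten j else 0)"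

lemma cten_eq: "cten j = (\<Prod>i\<in>{..<j}. avar i \<otimes> 1) * (\<Prod>i\<in>{j<..}. 1 \<otimes> avar i)"
  by (simp add: cten_def tensor_prod tensor_mult)

text \<open>By \<open>cliff_anticomm\<close> the anticommutator is a multiple of
  \<open>x_i c_i - \<Sum>_(j>i) c_j \<theta>_j\<close>. Telescoping over the indices above
  \<open>i\<close> shows that this is zero, as the product of all variables vanishes in the left
  factor.\<close>

lemma cliff_contr: "cliff Xdiff cten (contr i u) x = - contr i (cliff Xdiff cten u) x"
proof -
  let ?x = "\<lambda>l. avar l \<otimes> 1 :: ('a, 'b) env" and ?y = "\<lambda>l. 1 \<otimes> avar l :: ('a, 'b) env"
  have le: "- {i<..} = insert i {..<i}" by auto
  have "(\<Sum>j\<in>{i<..}. cten j * Xdiff j)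
      = (\<Prod>l\<in>-{i<..}. ?x l) * (\<Prod>l\<in>{i<..}. ?y l) - (\<Prod>l\<in>UNIV. ?x l)"
    unfolding cten_eq Xdiff_def by (rule telescope) auto
  also have "\<dots> = ?x i * cten i"
    unfolding le cten_eq by (simp add: tensor_prod prod_avar tensor_0_left tensor_mult)
  finally have sum: "(\<Sum>j\<in>{i<..}. cten j * Xdiff j) = ?x i * cten i" .
  have "(\<Sum>j\<in>UNIV. Xdiff j * (if i < j then - cten j else 0) + (if j = i then ?x i else 0) * cten j)
      = (\<Sum>j\<in>UNIV. if i < j then - (cten j * Xdiff j) else 0) + (\<Sum>j\<in>UNIV. if j = i then ?x i * cten i else 0)"
    unfolding sum.distrib[symmetric] by (intro sum.cong) (auto simp: mult.commute)
  also have "(\<Sum>j\<in>UNIV. if i < j then - (cten j * Xdiff j) else 0) = (\<Sum>j\<in>{i<..}. - (cten j * Xdiff j))"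
    by (rule sum.mono_neutral_cong_right) auto
  finally have "(\<Sum>j\<in>UNIV. Xdiff j * (if i < j then - cten j else 0)
      + (if j = i then ?x i else 0) * cten j) = 0"
    by (simp add: sum_negf sum)
  then have "cliff Xdiff cten (contr i u) x + contr i (cliff Xdiff cten u) x = 0"
    unfolding contr_def cliff_anticomm by simp
  then show ?thesis by (simp add: add_eq_0_iff)
qed

primrec contrs :: "'n::{finite,linorder} list \<Rightarrow> ('n set \<times> nat \<Rightarrow> ('n, 'k::field) env) \<Rightarrow>
    'n set \<times> nat \<Rightarrow> ('n, 'k) env" where
  "contrs [] u = u"
| "contrs (i # l) u = contrs l (contr i u)"

lemma contr_lin:
  "contr i (\<lambda>x. u x + v x) = (\<lambda>x. contr i u x + contr i v x)"
  "contr i (\<lambda>x. c * u x) = (\<lambda>x. c * contr i u x)"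
  by (rule ext, simp add: contr_def cliff_add cliff_mult)+

lemma contrs_add: "contrs l (\<lambda>x. u x + v x) x = contrs l u x + contrs l v x"
  by (induction l arbitrary: u v) (simp_all add: contr_lin)

lemma contrs_mult: "contrs l (\<lambda>x. c * u x) x = c * contrs l u x"
  by (induction l arbitrary: u) (simp_all add: contr_lin)

lemma cliff_contrs:
  fixes u :: "'n::{finite,linorder} set \<times> nat \<Rightarrow> ('n, 'k::field) env"
  shows "cliff Xdiff cten (contrs l u) x = (-1) ^ length l * contrs l (cliff Xdiff cten u) x"
proof (induction l arbitrary: u)
  case (Cons i l)
  have "cliff Xdiff cten (contr i u) = (\<lambda>x. - contr i (cliff Xdiff cten u) x)"
    by (rule ext) (rule cliff_contr)
  moreover have "contrs l (\<lambda>x. - v x) x = - contrs l v x" for v :: "'n set \<times> nat \<Rightarrow> ('n, 'k) env"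
    using contrs_mult[of l "-1" v x] by simp
  ultimately show ?case
    by (simp add: Cons)
qed simp

lemma supp_contrs: "supp (m + length l) u \<Longrightarrow> supp m (contrs l u)"
  by (induction l arbitrary: u) (simp_all add: contr_def supp_cliff)

text \<open>The term \<open>cre j\<close> contributes at \<open>J\<close> only when
  \<open>j \<in> J\<close>; then the variable \<open>x_j\<close> in \<open>xprod J\<close> completes
  the product of the other variables to zero. Only the contraction by \<open>i\<close> is
  left.\<close>

lemma xprod_cliff:
  fixes u :: "'n::{finite,linorder} set \<times> nat \<Rightarrow> ('n, 'k::field) alg"
  shows "xprod J * cliff (\<lambda>j. if j = i then avar i else 0)
      (\<lambda>j. if i < j then - xprod (- {j}) else 0) u (J, q)
    = (if i \<in> J then 0 else sg i J * xprod (insert i J) * u (insert i J, q))"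
proof -
  have zero: "xprod J * xprod (- {j}) = (0 :: ('n, 'k) alg)" if "j \<in> J" for j
  proof -
    have "xprod J = avar j * (xprod (J - {j}) :: ('n, 'k) alg)"
      using that by (simp add: prod.remove)
    then have "xprod J * xprod (- {j}) = xprod (J - {j}) * (avar j * xprod (- {j}) :: ('n, 'k) alg)"
      by (simp add: ac_simps)
    also have "avar j * xprod (- {j}) = (xprod UNIV :: ('n, 'k) alg)"
      by (simp add: prod.remove[of UNIV j] Compl_eq_Diff_UNIV)
    finally show ?thesis by (simp add: prod_avar)
  qed
  have cre: "xprod J * ((if i < j then - xprod (- {j}) else 0) * cre j u (J, q)) = 0" for j
    by (cases "j \<in> J") (simp_all add: cre_def zero mult.assoc[symmetric])
  have "xprod J * cliff (\<lambda>j. if j = i then avar i else 0)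
      (\<lambda>j. if i < j then - xprod (- {j}) else 0) u (J, q)
    = (\<Sum>j\<in>UNIV. if j = i then xprod J * (avar i * ann i u (J, q)) else 0)"
    unfolding cliff_def sum_distrib_left distrib_left cre by (intro sum.cong) auto
  also have "\<dots> = (if i \<in> J then 0 else sg i J * xprod (insert i J) * u (insert i J, q))"
    by (simp add: ann_def ac_simps)
  finally show ?thesis .
qed

lemma eps_cten: "eps (cten j) = xprod (- {j})"
proof -
  have "- {j} = {..<j} \<union> {j<..}" by auto
  moreover have "{..<j} \<inter> {j<..} = {}" by auto
  ultimately show ?thesis by (simp add: cten_def eps_tensor prod.union_disjoint)
qed

lemma eps_contr:
  fixes u :: "'n::{finite,linorder} set \<times> nat \<Rightarrow> ('n, 'k::field) env"
  shows "eps (contr i u x) = cliff (\<lambda>j. if j = i then avar i else 0)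
     (\<lambda>j. if i < j then - xprod (- {j}) else 0) (eps \<circ> u) x"
proof -
  have "eps (contr i u x) = cliff (eps \<circ> (\<lambda>j. if j = i then avar i \<otimes> 1 else 0))
      (eps \<circ> (\<lambda>j. if i < j then - cten j else 0)) (eps \<circ> u) x"
    unfolding contr_def by (rule cliff_hom) (simp_all add: eps_0 eps_add eps_mult eps_1)
  moreover have "eps \<circ> (\<lambda>j. if j = i then avar i \<otimes> 1 else 0) = (\<lambda>j. if j = i then avar i else 0 :: ('n, 'k) alg)"
    by (auto simp: eps_tensor eps_0)
  moreover have "eps \<circ> (\<lambda>j. if i < j then - cten j else 0) = (\<lambda>j. if i < j then - xprod (- {j}) else 0 :: ('n, 'k) alg)"
    by (auto simp: eps_uminus eps_cten eps_0)
  ultimately show ?thesis by simp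
qed

lemma wsgn_insert:
  assumes "i \<notin> L"
  shows "wsgn (insert i L) J = wsgn {i} J * wsgn L J"
proof -
  let ?P = "\<lambda>M. {(a, b). a \<in> M \<and> b \<in> J \<and> b < a}"
  have fin: "finite (?P M)" for M
    by (rule finite_subset[of _ "UNIV \<times> UNIV"]) auto
  have un: "?P (insert i L) = ?P {i} \<union> ?P L" by auto
  have "?P {i} \<inter> ?P L = {}" using assms by auto
  then have "card (?P (insert i L)) = card (?P {i}) + card (?P L)"
    unfolding un by (rule card_Un_disjoint[OF fin fin])
  then show ?thesis by (simp add: wsgn_def power_add)
qed

lemma xprod_eps_contrs:
  fixes u :: "'n::{finite,linorder} set \<times> nat \<Rightarrow> ('n, 'k::field) env"
  assumes "sorted_wrt (<) l"
  shows "xprod J * eps (contrs l u (J, q)) =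
    (if set l \<inter> J = {} then of_int (wsgn (set l) J) * xprod (set l \<union> J) * eps (u (set l \<union> J, q)) else 0)"
  using assms
proof (induction l arbitrary: u)
  case Nil
  show ?case by (simp add: wsgn_def)
next
  case (Cons i l)
  show ?case
  proof (cases "set (i # l) \<inter> J = {}")
    case True
    have i: "i \<notin> set l" "i \<notin> J" using Cons.prems True by auto
    \<comment> \<open>The list is strictly increasing, so its tail has no element below
      \<open>i\<close> and does not affect the sign.\<close>
    have "{k \<in> set l \<union> J. k < i} = {k \<in> J. k < i}" using Cons.prems by auto
    then have sg: "sg i (set l \<union> J) = (sg i J :: ('n, 'k) alg)" by (simp add: sg_def)
    have "xprod J * eps (contrs (i # l) u (J, q)) =
        of_int (wsgn (set l) J) * (xprod (set l \<union> J) * eps (contr i u (set l \<union> J, q)))"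
      using Cons True by (simp add: mult.assoc)
    also have "\<dots> = of_int (wsgn (set l) J) *
        (sg i J * xprod (insert i (set l \<union> J)) * eps (u (insert i (set l \<union> J), q)))"
      unfolding eps_contr xprod_cliff using i by (simp add: sg)
    also have "\<dots> = of_int (wsgn (set (i # l)) J) * xprod (set (i # l) \<union> J) * eps (u (set (i # l) \<union> J, q))"
      by (simp add: wsgn_insert[OF i(1)] wsgn_singleton ac_simps)
    finally show ?thesis using True by simp
  next
    case False
    have "xprod J * eps (contrs (i # l) u (J, q)) =
        (if set l \<inter> J = {} then of_int (wsgn (set l) J) *
          (xprod (set l \<union> J) * eps (contr i u (set l \<union> J, q))) else 0)"
      using Cons by (simp add: mult.assoc)
    also have "\<dots> = 0"
      unfolding eps_contr xprod_cliff using False by auto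
    finally show ?thesis unfolding if_not_P[OF False] .
  qed
qed

section \<open>Divisibility of the values of a cocycle\<close>

lemma coef_sg: "coef \<gamma> (sg i I * a) = sg i I * coef \<gamma> a"
proof -
  have "coef \<gamma> (- a) = - coef \<gamma> a"
    using coef_add[of \<gamma> a "- a"] by (simp add: coef_0 add_eq_0_iff)
  then show ?thesis
    by (cases "even (card {k\<in>I. k < i})") (simp_all add: sg_def)
qed

lemma coef_sum: "coef \<gamma> (sum g S) = (\<Sum>i\<in>S. coef \<gamma> (g i))"
  by (induction S rule: infinite_finite_induct) (simp_all add: coef_0 coef_add)

lemma coef_abs: "\<exists>i. lookup \<gamma> i = 0 \<Longrightarrow> coef \<gamma> (abs_alg u) = lookup u \<gamma>"
  by (simp only: coef.abs_eq if_True)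

lemma amonom_times_abs: "amonom \<alpha> * abs_alg u = abs_alg (single \<alpha> 1 * u)"
  by (simp add: amonom.abs_eq times_alg.abs_eq pmonom_def)

lemma coef_amonom_times:
  assumes "lookup (\<alpha> + \<gamma>) i = 0"
  shows "coef (\<alpha> + \<gamma>) (amonom \<alpha> * a) = coef \<gamma> a"
proof (induct a rule: alg.abs_induct)
  case (1 u)
  have "\<exists>i. lookup (\<alpha> + \<gamma>) i = 0" "\<exists>i. lookup \<gamma> i = 0"
    using assms by (auto simp: lookup_add)
  then show ?case
    by (simp only: amonom_times_abs coef_abs lookup_single_times_add mult_1)
qed

lemma coef_amonom_times_eq_0:
  assumes "lookup \<beta> i = 0" "lookup \<alpha> i \<noteq> 0"
  shows "coef \<beta> (amonom \<alpha> * a) = 0"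
proof (induct a rule: alg.abs_induct)
  case (1 u)
  have "\<beta> \<noteq> \<alpha> + \<gamma>" for \<gamma>
    using assms by (auto simp: lookup_add)
  then have "lookup (single \<alpha> 1 * u) \<beta> = 0"
    by (rule lookup_single_times_eq_0)
  moreover have "\<exists>i. lookup \<beta> i = 0" using assms(1) ..
  ultimately show ?case
    by (simp only: amonom_times_abs coef_abs)
qed

lemma xprod_dvd:
  fixes b :: "('n::finite, 'k::field) alg"
  assumes "\<And>\<gamma> j. j \<in> I \<Longrightarrow> lookup \<gamma> j = 0 \<Longrightarrow> coef \<gamma> b = 0"
  shows "xprod I dvd b"
  using assms
proof (induct b rule: alg.abs_induct)
  case (1 u)
  let ?K = "{\<gamma> \<in> keys u. \<forall>j\<in>I. lookup \<gamma> j \<noteq> 0}"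
  define u' where "u' = (\<Sum>\<gamma>\<in>?K. single \<gamma> (lookup u \<gamma>))"
  have u': "lookup u' \<gamma> = (if \<forall>j\<in>I. lookup \<gamma> j \<noteq> 0 then lookup u \<gamma> else 0)" for \<gamma>
    by (auto simp: u'_def lookup_sum lookup_single when_def in_keys_iff)
  have "abs_alg u = abs_alg u'"
  proof (rule alg_eqI)
    fix \<gamma> :: "'n \<Rightarrow>\<^sub>0 nat" assume ex: "\<exists>i. lookup \<gamma> i = 0"
    show "coef \<gamma> (abs_alg u) = coef \<gamma> (abs_alg u')"
    proof (cases "\<forall>j\<in>I. lookup \<gamma> j \<noteq> 0")
      case True
      then show ?thesis by (simp add: coef_abs[OF ex] u')
    next
      case False
      then have "coef \<gamma> (abs_alg u) = 0" using 1 by blast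
      with False show ?thesis by (simp add: coef_abs[OF ex] u')
    qed
  qed
  moreover have "single (expo I) 1 dvd u'"
  proof (rule single_dvd)
    fix \<beta> :: "'n \<Rightarrow>\<^sub>0 nat" and i assume "\<beta> \<in> keys u'"
    then have "lookup u' \<beta> \<noteq> 0" by (simp add: in_keys_iff)
    then have "i \<in> I \<Longrightarrow> lookup \<beta> i \<noteq> 0" by (auto simp: u' split: if_splits)
    then show "lookup (expo I) i \<le> lookup \<beta> i" by (cases "i \<in> I") (simp_all add: lookup_expo)
  qed
  then obtain w where "u' = single (expo I) 1 * w" ..
  ultimately have "abs_alg u = xprod I * abs_alg w"
    by (simp add: amonom_expo[symmetric] amonom_times_abs)
  then show ?case by simp
qed

text \<open>
  The sum of the ideals of \<open>A\<close> generated by the \<open>\<Prod>\<^bsub>l\<noteq>j\<^esub> x\<^sub>l\<close> is direct, since the nonzero monomials of the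
  \<open>j\<close>-th one are those in which exactly \<open>x\<^sub>j\<close> is missing. Hence each summand of \<open>f (d (e\<^bsub>I-{j}\<^esub> t\<^sup>(\<^sup>q\<^sup>+\<^sup>1\<^sup>)))\<close>
  vanishes.
\<close>

lemma cocycle_dvd:
  fixes f :: "('n::{finite,linorder}, 'k::field) cochain"
  assumes f: "f \<in> cocycles m" and x: "(I, q) \<in> basis m"
  shows "xprod I dvd f (gen I q)"
proof (rule xprod_dvd)
  fix \<gamma> :: "'n \<Rightarrow>\<^sub>0 nat" and j :: 'n
  assume j: "j \<in> I" and \<gamma>: "lookup \<gamma> j = 0"
  define I' where "I' = I - {j}"
  have I': "j \<notin> I'" "insert j I' = I" using j by (auto simp: I'_def)
  have "card I = Suc (card I')" unfolding I'_def using j by (intro card.remove) auto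
  then have g: "(gen I' (Suc q) :: ('n, 'k) res) \<in> F (Suc m)"
    using x by (intro F_gen) (simp add: basis_def)
  let ?\<delta> = "\<lambda>x. if x = (I', Suc q) then 1 else 0 :: ('n, 'k) alg"
  define h where "h i = (\<Sum>x\<in>basis m. cre i ?\<delta> x * f (gens x))" for i
  have eps: "eps (lookup (dF (gen I' (Suc q))) x) = (\<Sum>i\<in>UNIV. xprod (- {i}) * cre i ?\<delta> x)" for x
  proof -
    have 1: "eps \<circ> lookup (gen I' (Suc q)) = ?\<delta>" by (auto simp: lookup_gen eps_1 eps_0)
    have "eps (lookup (dF (gen I' (Suc q))) x) = cliff (eps \<circ> Xdiff) (eps \<circ> cten) ?\<delta> x"
      unfolding lookup_dF 1[symmetric]
      by (rule cliff_hom) (simp_all add: eps_0 eps_add eps_mult eps_1)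
    \<comment> \<open>Only the wedge part of the differential survives \<open>eps\<close>.\<close>
    moreover have "eps \<circ> Xdiff = (\<lambda>i. 0 :: ('n, 'k) alg)"
      by (auto simp: Xdiff_def eps_diff eps_tensor)
    ultimately show ?thesis by (simp add: cliff_def eps_cten)
  qed
  have "0 = f (dF (gen I' (Suc q)))"
    using f g by (simp add: cocycles_iff)
  also have "\<dots> = (\<Sum>x\<in>basis m. eps (lookup (dF (gen I' (Suc q))) x) * f (gens x))"
    using f g by (intro linA_expand) (simp_all add: cocycles_iff dF_F)
  also have "\<dots> = (\<Sum>i\<in>UNIV. amonom (expo (- {i})) * h i)"
    unfolding eps h_def sum_distrib_left sum_distrib_right amonom_expo
    by (subst sum.swap) (simp add: mult.assoc)
  \<comment> \<open>This exponent omits \<open>j\<close>, while every summand with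
    \<open>i \<noteq> j\<close> is a multiple of \<open>x_j\<close>; so the coefficient isolates the
    summand for \<open>j\<close>.\<close>
  finally have "0 = coef (expo (- {j}) + \<gamma>) (\<Sum>i\<in>UNIV. amonom (expo (- {i})) * h i)"
    by (simp add: coef_0)
  also have "\<dots> = (\<Sum>i\<in>UNIV. if i = j then coef \<gamma> (h j) else 0)"
    unfolding coef_sum
  proof (rule sum.cong)
    fix i
    have z: "lookup (expo (- {j}) + \<gamma>) j = 0" by (simp add: lookup_add lookup_expo \<gamma>)
    show "coef (expo (- {j}) + \<gamma>) (amonom (expo (- {i})) * h i) = (if i = j then coef \<gamma> (h j) else 0)"
    proof (cases "i = j")
      case True
      then show ?thesis using coef_amonom_times[OF z] by simp
    next
      case False
      then show ?thesis using coef_amonom_times_eq_0[OF z, of "expo (- {i})" "h i"]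
        by (simp add: lookup_expo)
    qed
  qed simp
  finally have "coef \<gamma> (h j) = 0" by simp
  moreover have "h j = sg j I * f (gen I q)"
  proof -
    have "cre j ?\<delta> x = (if x = (I, q) then sg j I else 0)" for x
      using I' by (cases x) (auto simp: cre_def)
    then show ?thesis
      using x by (simp add: h_def finite_basis if_distrib[of "\<lambda>z. z * _"] cong: if_cong)
  qed
  ultimately have "sg j I * (sg j I * coef \<gamma> (f (gen I q))) = 0"
    by (simp add: coef_sg)
  then show "coef \<gamma> (f (gen I q)) = 0" by (simp only: sg_sq_left)
qed

section \<open>The product on cochains and the explicit lift\<close>

definition prod_cochain :: "nat \<Rightarrow> nat \<Rightarrow> ('n::{finite,linorder}, 'k::field) cochain \<Rightarrow>
    ('n, 'k) cochain \<Rightarrow> ('n, 'k) cochain" where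
  "prod_cochain i j f g = (\<lambda>v\<in>F (i + j). \<Sum>x\<in>basis i. \<Sum>y\<in>basis j.
     if fst x \<inter> fst y = {}
     then of_int (wsgn (fst x) (fst y)) * f (gens x) * g (gens y) *
       eps (lookup v (fst x \<union> fst y, snd y + snd x))
     else 0)"

text \<open>The sum of the operators \<open>a X_I\<close> after \<open>shift p\<close>, where
  \<open>a\<close> is meant to be the cofactor of \<open>x_I\<close> in the value of the cocycle at
  \<open>e_I t^(p)\<close>. The sign needed for a chain map is added later.\<close>

definition lift_fun :: "nat \<Rightarrow> ('n::{finite,linorder} set \<times> nat \<Rightarrow> ('n, 'k::field) alg) \<Rightarrow>
    ('n set \<times> nat \<Rightarrow> ('n, 'k) env) \<Rightarrow> 'n set \<times> nat \<Rightarrow> ('n, 'k) env" where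
  "lift_fun i a u = (\<lambda>y. \<Sum>x\<in>basis i.
     (a x \<otimes> 1) * contrs (sorted_list_of_set (fst x)) (shift (snd x) u) y)"

lemma shift_lin:
  "shift p (\<lambda>x. u x + v x) = (\<lambda>x. shift p u x + shift p v x)"
  "shift p (\<lambda>x. c * u x) = (\<lambda>x. c * shift p u x)" for u :: "_ \<Rightarrow> 'r::comm_ring_1"
  by (auto simp: shift_def)

lemma lift_fun_add: "lift_fun i a (\<lambda>x. u x + v x) y = lift_fun i a u y + lift_fun i a v y"
  by (simp add: lift_fun_def shift_lin contrs_add distrib_left sum.distrib)

lemma lift_fun_mult: "lift_fun i a (\<lambda>x. c * u x) y = c * lift_fun i a u y"
  by (simp add: lift_fun_def shift_lin contrs_mult sum_distrib_left mult.left_commute)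

lemma supp_lift_fun:
  assumes "supp (i + l) u"
  shows "supp l (lift_fun i a u)"
proof -
  have "supp l (contrs (sorted_list_of_set (fst x)) (shift (snd x) u))" if "x \<in> basis i" for x
  proof (intro supp_contrs supp_shift)
    have "i + l = l + length (sorted_list_of_set (fst x)) + 2 * snd x"
      using that by (auto simp: basis_def)
    then show "supp (l + length (sorted_list_of_set (fst x)) + 2 * snd x) u"
      using assms by (rule subst[of _ _ "\<lambda>k. supp k u"])
  qed
  then show ?thesis by (simp add: supp_def lift_fun_def)
qed

text \<open>Moving the differential past the factors \<open>X_i\<close> gives
  \<open>(-1) ^ card I\<close>, and \<open>card I\<close> has the parity of \<open>i\<close> because
  divided powers have even degree.\<close>

lemma cliff_lift_fun:
  "cliff Xdiff cten (lift_fun i a u) y = (-1) ^ i * lift_fun i a (cliff Xdiff cten u) y"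
proof -
  have "(-1) ^ card (fst x) = ((-1) ^ i :: ('a, 'b) env)" if "x \<in> basis i" for x :: "'a set \<times> nat"
    using that by (auto simp: basis_def power_add)
  then show ?thesis
    unfolding lift_fun_def cliff_sum cliff_mult cliff_contrs cliff_shift sum_distrib_left
    by (intro sum.cong) (simp_all add: mult.left_commute)
qed

text \<open>Here \<open>c\<close> stands for the values of the first cocycle. The factor
  \<open>xprod J\<close>, which suppresses the correction terms of \<open>contr\<close>, will come
  from the second one.\<close>

lemma xprod_eps_lift_fun:
  assumes "\<forall>x\<in>basis i. c x = xprod (fst x) * a x"
  shows "xprod J * eps (lift_fun i a u (J, q)) =
    (\<Sum>x\<in>basis i. if fst x \<inter> J = {}
      then of_int (wsgn (fst x) J) * c x * xprod J * eps (u (fst x \<union> J, q + snd x)) else 0)"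
proof -
  have eps_sum: "eps (sum g S) = (\<Sum>i\<in>S. eps (g i))" for g :: "'a set \<times> nat \<Rightarrow> ('a, 'b) env" and S
    by (induction S rule: infinite_finite_induct) (simp_all add: eps_0 eps_add)
  have "xprod J * eps (lift_fun i a u (J, q)) = (\<Sum>x\<in>basis i.
      a x * (xprod J * eps (contrs (sorted_list_of_set (fst x)) (shift (snd x) u) (J, q))))"
    by (simp add: lift_fun_def eps_sum eps_mult eps_tensor sum_distrib_left mult.left_commute)
  also have "\<dots> = (\<Sum>x\<in>basis i. if fst x \<inter> J = {}
      then of_int (wsgn (fst x) J) * c x * xprod J * eps (u (fst x \<union> J, q + snd x)) else 0)"
    by (intro sum.cong refl, subst xprod_eps_contrs)
      (auto simp: assms shift_def prod.union_disjoint ac_simps)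
  finally show ?thesis .
qed

lemma lookup_Abs:
  fixes u :: "'n::{finite,linorder} set \<times> nat \<Rightarrow> ('n, 'k::field) env"
  shows "supp m u \<Longrightarrow> lookup (Abs_poly_mapping u) = u"
  using ex_lookup[of m u] by (metis lookup_inverse)

lemma cocycle_factor:
  assumes "f \<in> cocycles i"
  shows "\<exists>a. \<forall>x\<in>basis i. f (gens x) = xprod (fst x) * a x"
proof -
  have "\<forall>x\<in>basis i. \<exists>a. f (gens x) = xprod (fst x) * a"
    using cocycle_dvd[OF assms] by (auto simp: dvd_def)
  then show ?thesis by (rule bchoice)
qed

lemma ex_lift:
  assumes f: "f \<in> cocycles i"
  shows "\<exists>ft. is_lift i f ft \<and> (\<forall>j g. g \<in> cocycles j \<longrightarrow>
    (\<lambda>v\<in>F (i + j). (-1) ^ (i * j) * g (ft j v)) = prod_cochain i j f g)"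
proof -
  obtain a where a: "\<forall>x\<in>basis i. f (gens x) = xprod (fst x) * a x"
    using cocycle_factor[OF f] by blast
  note eps_lift = xprod_eps_lift_fun[OF a]
  \<comment> \<open>The sign \<open>(-1) ^ (i * l)\<close> turns commutation up to
    \<open>(-1) ^ i\<close> into strict commutation; at \<open>l = j\<close> it cancels the sign in
    \<open>cup\<close>.\<close>
  define ft where "ft l = (\<lambda>v\<in>F (i + l).
      Abs_poly_mapping (\<lambda>y. (-1) ^ (i * l) * lift_fun i a (lookup v) y))" for l
  have s: "supp l (\<lambda>y. (-1) ^ (i * l) * lift_fun i a (lookup v) y)" if "v \<in> F (i + l)" for l v
    using supp_lift_fun[of i l "lookup v" a] that by (simp add: F_iff supp_def)
  have lookup_ft: "lookup (ft l v) = (\<lambda>y. (-1) ^ (i * l) * lift_fun i a (lookup v) y)"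
    if "v \<in> F (i + l)" for l v
    using lookup_Abs[OF s[OF that]] that by (simp add: ft_def)
  have lookup_fun: "lookup (v + w) = (\<lambda>x. lookup v x + lookup w x)" "lookup (smul c v) = (\<lambda>x. c * lookup v x)"
    for v w and c
    by (auto simp: lookup_add lookup_smul)
  have ft_F: "ft l v \<in> F l" if "v \<in> F (i + l)" for l v
    using s[OF that] by (simp add: F_iff lookup_ft[OF that])
  have "is_lift i f ft"
    unfolding is_lift_def
  proof (intro conjI allI ballI)
    fix l
    show "ft l \<in> HomFF (i + l) l"
      unfolding HomFF_def
    proof (intro CollectI conjI allI ballI)
      show "ft l \<in> F (i + l) \<rightarrow>\<^sub>E F l"
        using ft_F by (auto simp: ft_def)
      show "ft l (v + w) = ft l v + ft l w" if "v \<in> F (i + l)" "w \<in> F (i + l)" for v w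
        by (rule poly_mapping_eqI)
          (simp add: lookup_ft that F_add lookup_add[of "ft l v"] lookup_fun lift_fun_add distrib_left)
      show "ft l (smul c v) = smul c (ft l v)" if "v \<in> F (i + l)" for c v
        by (rule poly_mapping_eqI)
          (simp add: lookup_ft that F_smul lookup_smul[of _ "ft l v"] lookup_fun lift_fun_mult mult.left_commute)
    qed
  next
    fix v :: "('a, 'b) res" assume v: "v \<in> F i"
    \<comment> \<open>The empty product is 1, which makes \<open>eps_lift\<close> applicable with
      \<open>J = {}\<close>.\<close>
    have "aug (ft 0 v) = xprod {} * eps (lift_fun i a (lookup v) ({}, 0))"
      using lookup_ft[of v 0] v by (simp add: aug_def)
    also have "\<dots> = (\<Sum>x\<in>basis i. eps (lookup v x) * f (gens x))"
      unfolding eps_lift by (simp add: wsgn_def mult.commute)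
    also have "\<dots> = f v"
      using f v by (intro linA_expand[symmetric]) (simp_all add: cocycles_iff)
    finally show "aug (ft 0 v) = f v" .
  next
    fix l and v :: "('a, 'b) res" assume v: "v \<in> F (i + Suc l)"
    then have dv: "dF v \<in> F (i + l)" by (intro dF_F) simp
    have "(-1) ^ (i * Suc l) * ((-1) ^ i * z) = (-1) ^ (i * l) * z" for z :: "('a, 'b) env"
      by (cases "even i") (simp_all add: power_add)
    then show "dF (ft (Suc l) v) = ft l (dF v)"
      by (intro poly_mapping_eqI)
        (simp add: lookup_dF lookup_ft[OF v] lookup_ft[OF dv] cliff_mult cliff_lift_fun del: mult_Suc_right)
  qed
  moreover have "(\<lambda>v\<in>F (i + j). (-1) ^ (i * j) * g (ft j v)) = prod_cochain i j f g"
    if g: "g \<in> cocycles j" for j g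
  proof (rule ext)
    fix v
    \<comment> \<open>The values of \<open>g\<close> provide the factor \<open>xprod (fst y)\<close>
      that \<open>eps_lift\<close> needs.\<close>
    obtain b where b: "\<And>y. y \<in> basis j \<Longrightarrow> g (gens y) = xprod (fst y) * b y"
      using cocycle_factor[OF g] by blast
    have "(-1) ^ (i * j) * g (ft j v) = prod_cochain i j f g v" if v: "v \<in> F (i + j)"
    proof -
      have "g (ft j v) = (\<Sum>y\<in>basis j. eps (lookup (ft j v) y) * g (gens y))"
        using g ft_F[OF v] by (intro linA_expand) (simp_all add: cocycles_iff)
      also have "\<dots> = (\<Sum>y\<in>basis j. (-1) ^ (i * j) *
          (b y * (xprod (fst y) * eps (lift_fun i a (lookup v) (fst y, snd y)))))"
      proof (rule sum.cong)
        have pow: "eps ((-1) ^ k) = (-1) ^ k" for k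
          by (cases "even k") (simp_all add: eps_1 eps_uminus)
        show "eps (lookup (ft j v) y) * g (gens y) = (-1) ^ (i * j) *
          (b y * (xprod (fst y) * eps (lift_fun i a (lookup v) (fst y, snd y))))" if "y \<in> basis j" for y
          by (simp add: lookup_ft[OF v] b[OF that] eps_mult pow ac_simps)
      qed simp
      also have "\<dots> = (-1) ^ (i * j) * (\<Sum>y\<in>basis j. \<Sum>x\<in>basis i.
          if fst x \<inter> fst y = {} then of_int (wsgn (fst x) (fst y)) * f (gens x) * (xprod (fst y) * b y) *
            eps (lookup v (fst x \<union> fst y, snd y + snd x)) else 0)"
        unfolding eps_lift sum_distrib_left
        by (intro sum.cong) (auto simp: ac_simps)
      also have "\<dots> = (-1) ^ (i * j) * prod_cochain i j f g v"
        unfolding prod_cochain_def using v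
        by (subst sum.swap) (simp add: b cong: if_cong sum.cong)
      finally show ?thesis by (simp flip: mult.assoc power_add)
    qed
    then show "(\<lambda>v\<in>F (i + j). (-1) ^ (i * j) * g (ft j v)) v = prod_cochain i j f g v"
      by (auto simp: prod_cochain_def)
  qed
  ultimately show ?thesis by blast
qed

lemma
  assumes "f \<in> cocycles i" "g \<in> cocycles j"
  shows cup_prod_cochain: "cup i j (HH_class i f) (HH_class j g) = HH_class (i + j) (prod_cochain i j f g)"
    and prod_cochain_cocycle: "prod_cochain i j f g \<in> cocycles (i + j)"
proof -
  obtain ft where ft: "is_lift i f ft"
    "(\<lambda>v\<in>F (i + j). (-1) ^ (i * j) * g (ft j v)) = prod_cochain i j f g"
    using ex_lift[OF assms(1)] assms(2) by blast
  show "cup i j (HH_class i f) (HH_class j g) = HH_class (i + j) (prod_cochain i j f g)"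
    using cup_class[OF ft(1) assms] by (simp add: ft(2))
  have "(\<lambda>v\<in>F (i + j). (-1) ^ (i * j) * (\<lambda>v\<in>F (i + j). g (ft j v)) v) \<in> cocycles (i + j)"
    by (intro cocycle_times lift_comp_cocycle[OF ft(1) assms(2)])
  then show "prod_cochain i j f g \<in> cocycles (i + j)"
    by (simp add: ft(2)[symmetric] cong: restrict_cong)
qed

text \<open>Each pair in \<open>I \<times> J\<close> is an inversion for one of the two orders,
  since disjointness excludes equal entries.\<close>

lemma wsgn_commute:
  assumes "I \<inter> J = {}"
  shows "wsgn I J = (-1) ^ (card I * card J) * wsgn J I"
proof -
  let ?P = "\<lambda>M N. {(a, b). a \<in> M \<and> b \<in> N \<and> b < a}"
  have fin: "finite A" for A :: "('a \<times> 'a) set" by (rule finite_subset[of _ "UNIV \<times> UNIV"]) auto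
  have un: "I \<times> J = ?P I J \<union> prod.swap ` ?P J I"
    using assms by (auto simp: image_iff)
  have "?P I J \<inter> prod.swap ` ?P J I = {}" by auto
  then have "card (I \<times> J) = card (?P I J) + card (prod.swap ` ?P J I)"
    unfolding un by (rule card_Un_disjoint[OF fin fin])
  then have "card I * card J = card (?P I J) + card (?P J I)"
    by (simp add: card_image card_cartesian_product)
  moreover have "(-1) ^ k * (-1) ^ k = (1 :: int)" for k
    by (simp flip: power_add)
  ultimately show ?thesis by (simp add: wsgn_def power_add mult.assoc)
qed

lemma prod_cochain_commute:
  "prod_cochain i j f g = (\<lambda>v\<in>F (i + j). (-1) ^ (i * j) * prod_cochain j i g f v)"
proof (rule ext)
  fix v
  have *: "(if fst x \<inter> fst y = {}
      then of_int (wsgn (fst x) (fst y)) * f (gens x) * g (gens y) *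
        eps (lookup v (fst x \<union> fst y, snd y + snd x)) else 0)
    = (-1) ^ (i * j) * (if fst y \<inter> fst x = {}
      then of_int (wsgn (fst y) (fst x)) * g (gens y) * f (gens x) *
        eps (lookup v (fst y \<union> fst x, snd x + snd y)) else 0)"
    if "x \<in> basis i" "y \<in> basis j" for x y
  proof (cases "fst x \<inter> fst y = {}")
    case True
    \<comment> \<open>Cardinality and degree of a basis element have the same parity.\<close>
    have "even (card (fst x) * card (fst y)) \<longleftrightarrow> even (i * j)"
      using that by (auto simp: basis_def)
    then have "(-1) ^ (card (fst x) * card (fst y)) = ((-1) ^ (i * j) :: int)"
      by (metis neg_one_even_power neg_one_odd_power)
    then have "of_int (wsgn (fst x) (fst y)) = (-1) ^ (i * j) * (of_int (wsgn (fst y) (fst x)) :: ('a, 'b) alg)"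
      using wsgn_commute[OF True] by simp
    then show ?thesis
      using True by (simp add: Int_commute Un_commute ac_simps)
  qed (simp add: Int_commute)
  show "prod_cochain i j f g v = (\<lambda>v\<in>F (i + j). (-1) ^ (i * j) * prod_cochain j i g f v) v"
  proof (cases "v \<in> F (i + j)")
    case True
    then show ?thesis
      by (simp add: prod_cochain_def add.commute[of j i] sum_distrib_left *
          sum.swap[of _ "basis j"] cong: sum.cong)
  qed (simp add: prod_cochain_def)
qed

lemma std_gens:
  assumes "x \<in> basis (card I + 2 * p)"
  shows "std I p \<alpha> (gens x) = (if x = (I, p) then amonom \<alpha> else 0)"
  using gens_F[OF assms] by (cases x) (auto simp: std_def act_def lookup_gen eps_0 eps_1)

lemma prod_cochain_std:
  fixes I J :: "'n::{finite,linorder} set"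
  assumes i: "i = card I + 2 * p" and j: "j = card J + 2 * q"
  shows "prod_cochain i j (std I p \<alpha>) (std J q \<beta>) = (\<lambda>v\<in>F (i + j).
    if I \<inter> J = {} then of_int (wsgn I J) * std (I \<union> J) (p + q) (\<alpha> + \<beta>) v else (0 :: ('n, 'k::field) alg))"
proof (rule ext)
  fix v
  show "prod_cochain i j (std I p \<alpha>) (std J q \<beta>) v = (\<lambda>v\<in>F (i + j).
    if I \<inter> J = {} then of_int (wsgn I J) * std (I \<union> J) (p + q) (\<alpha> + \<beta>) v else (0 :: ('n, 'k) alg)) v"
  proof (cases "v \<in> F (i + j)")
    case True
    let ?T = "\<lambda>x y. if fst x \<inter> fst y = {}
     then of_int (wsgn (fst x) (fst y)) * std I p \<alpha> (gens x) * std J q \<beta> (gens y) *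
       eps (lookup v (fst x \<union> fst y, snd y + snd x)) else (0 :: ('n, 'k) alg)"
    let ?t = "if I \<inter> J = {} then of_int (wsgn I J) * amonom \<alpha> * amonom \<beta> * eps (lookup v (I \<union> J, q + p)) else 0"
    \<comment> \<open>Only one pair of basis elements contributes to the double sum.\<close>
    have T: "?T x y = (if y = (J, q) then if x = (I, p) then ?t else 0 else 0)"
      if "x \<in> basis i" "y \<in> basis j" for x y
      unfolding std_gens[OF that(1)[unfolded i]] std_gens[OF that(2)[unfolded j]] by auto
    have "(I, p) \<in> basis i" "(J, q) \<in> basis j" by (simp_all add: basis_def i j)
    then have "(\<Sum>x\<in>basis i. \<Sum>y\<in>basis j. ?T x y) = ?t"
      by (simp add: T finite_basis cong: sum.cong)
    moreover have "?t = (if I \<inter> J = {} then of_int (wsgn I J) * std (I \<union> J) (p + q) (\<alpha> + \<beta>) v else 0)"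
    proof (cases "I \<inter> J = {}")
      case disj: True
      then have "card (I \<union> J) + 2 * (p + q) = i + j" by (simp add: card_Un_disjoint i j)
      then show ?thesis
        using True disj by (simp add: std_def act_def amonom_add ac_simps)
    qed simp
    ultimately show ?thesis using True by (simp only: prod_cochain_def restrict_apply')
  qed (simp add: prod_cochain_def)
qed

theorem proposition4p1:
  fixes I J :: "'n::{finite,linorder} set" and p q :: nat and \<alpha> \<beta> :: "'n \<Rightarrow>\<^sub>0 nat"
    and f g :: "('n, 'k::field) cochain" and i j :: nat
  assumes "\<not> (pvar_prod :: ('n, 'k) mpoly) dvd pmonom \<alpha>"
    and "\<not> (pvar_prod :: ('n, 'k) mpoly) dvd pmonom \<beta>"
    and "i = card I + 2 * p" and "f = std I p \<alpha>" and "f \<in> cocycles i"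
    and "j = card J + 2 * q" and "g = std J q \<beta>" and "g \<in> cocycles j"
  shows "(cup i j (HH_class i f) (HH_class j g) =
      (if I \<inter> J = {} then HH_scale (i + j) (wsgn I J) (HH_class (i + j) (std (I \<union> J) (p + q) (\<alpha> + \<beta>)))
       else HH_class (i + j) (zero_cochain (i + j)))) \<and>
    (\<forall>r s. \<forall>U\<in>(HH r :: ('n, 'k) cochain set set). \<forall>V\<in>HH s.
      cup r s U V = HH_scale (r + s) ((-1) ^ (r * s)) (cup s r V U))"
proof (intro conjI allI ballI)
  let ?h = "std (I \<union> J) (p + q) (\<alpha> + \<beta>) :: ('n, 'k) cochain"
  have cup: "cup i j (HH_class i f) (HH_class j g) = HH_class (i + j) (prod_cochain i j f g)"
    by (rule cup_prod_cochain[OF assms(5,8)])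
  have prod: "prod_cochain i j f g = (\<lambda>v\<in>F (i + j).
      if I \<inter> J = {} then of_int (wsgn I J) * ?h v else 0)"
    unfolding assms(4,7) by (rule prod_cochain_std[OF assms(3,6)])
  show "cup i j (HH_class i f) (HH_class j g) =
      (if I \<inter> J = {} then HH_scale (i + j) (wsgn I J) (HH_class (i + j) ?h)
       else HH_class (i + j) (zero_cochain (i + j)))"
  proof (cases "I \<inter> J = {}")
    case True
    then have deg: "i + j = card (I \<union> J) + 2 * (p + q)"
      by (simp add: card_Un_disjoint assms(3,6))
    \<comment> \<open>The sign is its own inverse, so \<open>?h\<close> is a multiple of the product
      cocycle and hence a cocycle, as \<open>HH_scale_class\<close> requires.\<close>
    have "wsgn I J * wsgn I J = 1" by (simp add: wsgn_def flip: power_add)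
    then have "of_int (wsgn I J) * (of_int (wsgn I J) * z) = z" for z :: "('n, 'k) alg"
      by (simp flip: mult.assoc of_int_mult)
    then have "?h = (\<lambda>v\<in>F (i + j). of_int (wsgn I J) * prod_cochain i j f g v)"
      using True by (auto simp: prod deg std_def)
    then have "?h \<in> cocycles (i + j)"
      using cocycle_times[OF prod_cochain_cocycle[OF assms(5,8)]] by simp
    then show ?thesis
      using True by (simp add: cup prod HH_scale_class)
  next
    case False
    then show ?thesis by (simp add: cup prod zero_cochain_def)
  qed
next
  fix r s and U V :: "('n, 'k) cochain set"
  assume "U \<in> HH r" "V \<in> HH s"
  then obtain f' g' where f': "U = HH_class r f'" "f' \<in> cocycles r"
    and g': "V = HH_class s g'" "g' \<in> cocycles s"
    by (auto simp: HH_def)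
  have "prod_cochain s r g' f' \<in> cocycles (r + s)"
    using prod_cochain_cocycle[OF g'(2) f'(2)] by (simp add: add.commute)
  then have "HH_scale (r + s) ((-1) ^ (r * s)) (HH_class (r + s) (prod_cochain s r g' f'))
      = HH_class (r + s) (prod_cochain r s f' g')"
    unfolding prod_cochain_commute[of r s] by (simp add: HH_scale_class)
  then show "cup r s U V = HH_scale (r + s) ((-1) ^ (r * s)) (cup s r V U)"
    unfolding f'(1) g'(1) cup_prod_cochain[OF f'(2) g'(2)] cup_prod_cochain[OF g'(2) f'(2)]
    by (simp add: add.commute)
qed

end
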